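(* Let $G$ be a finite, simple and connected digraph with Ihara zeta function $\zeta(G,u)$. Let $\Sigma=\{h_1,\dots,h_n\}$ be the set of all simple cycles of the line digraph without backtracks $L_{WB}(G)$, with $\#\Sigma=n$, let $\mathcal{H}=\Sigma^*/I_{\mathcal{H}}$ be the hike monoid, and let $\tilde{G}_+(\mathcal{H})$ be a closure of the noncommutation graph $\tilde{G}(\mathcal{H})$. Let $A(\tilde{G}_+(\mathcal{H}))$ be the $n\times n$ adjacency matrix of $\tilde{G}_+(\mathcal{H})$ (rows and columns indexed by $h_1,\dots,h_n$) and let $D_w(\tilde{G}_+(\mathcal{H}))=\mathrm{diag}[u^{l(h_1)},\dots,u^{l(h_n)}]$, where $l(h_i)$ is the length of the cycle $h_i$ in $L_{WB}(G)$. Then $$\zeta(G,u)^{-1}=\det\bigl(I_n-D_w(\tilde{G}_+(\mathcal{H}))\,A(\tilde{G}_+(\mathcal{H}))\bigr).$$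
   Context: Digraphs: a digraph $G=(V(G),E(G))$ has directed edges $e=(u,v)$ with origin $o(e)=u$ and terminus $t(e)=v$. It is simple if it has no directed loops and no multiple directed edges, and connected if its underlying undirected graph is connected. If $e=(u,v)$ and $(v,u)$ are both edges, write $e^{-1}=(v,u)$; if $(v,u)\notin E(G)$, the condition $e^{-1}\neq f$ holds for every edge $f$. A cycle of length $m\ge 1$ in a digraph is a sequence of edges $C=(e_1,\dots,e_m)$ with $t(e_k)=o(e_{k+1})$ for $1\le k<m$ and $t(e_m)=o(e_1)$; $l(C)=m$. It is prime if it is not $B^r$ for a cycle $B$ and an integer $r\ge2$; reduced if $e_{k+1}^{-1}\neq e_k$ for all $1\le k\le m$ (with $e_{m+1}=e_1$); simple if $o(e_1),\dots,o(e_m)$ are distinct. Two cycles are equivalent if they differ by a cyclic rotation. Ihara zeta function: $\zeta(G,u)=\prod_{[C]}(1-u^{l(C)})^{-1}$ (a formal power series in $u$), the product over all equivalence classes of prime and reduced cycles of $G$. Line digraph without backtracks $L_{WB}(G)$: vertex set $E(G)$, edge set $\{(e,f): e,f\in E(G),\ t(e)=o(f),\ e^{-1}\neq f\}$. Hike monoid: $\Sigma$ is the (finite) set of all simple cycles of $L_{WB}(G)$, where cycles differing by a cyclic rotation are identified. For $h\in\Sigma$, $V(h)\subseteq V(L_{WB}(G))$ is the set of vertices visited by $h$. $\mathcal{H}=\Sigma^*/I_{\mathcal{H}}$ is the quotient of the free monoid $\Sigma^*$ by the congruence generated by $h_ih_j=h_jh_i$ for $(h_i,h_j)\in I_{\mathcal{H}}$,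 where $(h_i,h_j)\in I_{\mathcal{H}}\iff V(h_i)\cap V(h_j)=\emptyset$. The noncommutation graph $\tilde{G}(\mathcal{H})$ is the undirected graph with vertex set $\Sigma$ and edges $\{h_i,h_j\}$ for $(h_i,h_j)\notin I_{\mathcal{H}}$ (so it has a loop at each vertex). Closure: a closure of $\tilde{G}(\mathcal{H})$ is a digraph $\tilde{G}_+(\mathcal{H})=(\Sigma,E)$ such that: (a) $(h_i,h_i)\in E$ for every $i$; (b) if $i\neq j$ and $\{h_i,h_j\}\in E(\tilde{G}(\mathcal{H}))$ then both $(h_i,h_j),(h_j,h_i)\in E$; (c) if $i\ne j$ and $\{h_i,h_j\}\notin E(\tilde{G}(\mathcal{H}))$ then exactly one of $(h_i,h_j),(h_j,h_i)$ is in $E$; and for every triple of distinct vertices $h_s,h_t,h_u$: (1) if $\{h_s,h_t\}\in E(\tilde{G}(\mathcal{H}))$ but $\{h_s,h_u\},\{h_t,h_u\}\notin E(\tilde{G}(\mathcal{H}))$, then either $(h_s,h_u),(h_t,h_u)\in E$ or $(h_u,h_s),(h_u,h_t)\in E$; (2) if none of the three pairs is an edge of $\tilde{G}(\mathcal{H})$, then the orientation on the triple is not a directed $3$-cycle $h_s\to h_t\to h_u\to h_s$. A closure need not exist nor be unique; the statement concerns any closure when one exists. The adjacency matrix has $(i,j)$ entry $1$ if $(h_i,h_j)\in E$ and $0$ otherwise. *)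

theory Defs
  imports
    "Graph_Theory.Digraph_Component"
    "Jordan_Normal_Form.Determinant"
    "HOL-Algebra.Group"
    "HOL-Computational_Algebra.Formal_Power_Series"
begin

section \<open>Cycles and their classes\<close>

text \<open>A cycle is a nonempty closed arc walk; unlike for the library's \<open>cycle\<close>, vertices and arcs
  may be repeated.\<close>

definition is_cycle :: "'v pair_pre_digraph \<Rightarrow> ('v \<times> 'v) list \<Rightarrow> bool" where
  "is_cycle G C \<longleftrightarrow> C \<noteq> [] \<and> (\<exists>u. pre_digraph.awalk (with_proj G) u C u)"

definition prime_cycle :: "'v pair_pre_digraph \<Rightarrow> ('v \<times> 'v) list \<Rightarrow> bool" where
  "prime_cycle G C \<longleftrightarrow> is_cycle G C \<and>
     \<not> (\<exists>B r. is_cycle G B \<and> r \<ge> 2 \<and> C = concat (replicate r B))"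

text \<open>\<open>prod.swap\<close> is the inverse edge. If the swapped pair is not an arc of \<open>G\<close>, it differs from
  every arc of \<open>G\<close>, so the inequalities below hold without a case distinction.\<close>

definition reduced_cycle :: "'v pair_pre_digraph \<Rightarrow> ('v \<times> 'v) list \<Rightarrow> bool" where
  "reduced_cycle G C \<longleftrightarrow> is_cycle G C \<and>
     (\<forall>k < length C. prod.swap (C ! (Suc k mod length C)) \<noteq> C ! k)"

definition simple_cycle :: "'v pair_pre_digraph \<Rightarrow> ('v \<times> 'v) list \<Rightarrow> bool" where
  "simple_cycle G C \<longleftrightarrow> is_cycle G C \<and> distinct (map fst C)"

definition rotation_rel :: "('e list \<times> 'e list) set" where
  "rotation_rel = {(C, D). \<exists>k. D = rotate k C}"

definition prime_reduced_classes :: "'v pair_pre_digraph \<Rightarrow> ('v \<times> 'v) list set set" where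
  "prime_reduced_classes G = {C. prime_cycle G C \<and> reduced_cycle G C} // rotation_rel"

definition simple_classes :: "'v pair_pre_digraph \<Rightarrow> ('v \<times> 'v) list set set" where
  "simple_classes G = {C. simple_cycle G C} // rotation_rel"

definition class_length :: "'e list set \<Rightarrow> nat" where
  "class_length c = length (SOME C. C \<in> c)"

definition class_verts :: "('v \<times> 'v) list set \<Rightarrow> 'v set" where
  "class_verts c = (\<Union>C\<in>c. fst ` set C)"


section \<open>The Ihara zeta function\<close>

text \<open>The product over all classes is the unordered infinite product, i.e. the limit of the
  finite partial products in the usual topology on formal power series. Lemma \<open>ihara_zeta_converges\<close>
  below shows that the limit exists for every finite digraph.\<close>

definition ihara_zeta :: "'v pair_pre_digraph \<Rightarrow> rat fps" where
  "ihara_zeta G = Lim (finite_subsets_at_top (prime_reduced_classes G))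
     (\<lambda>F. \<Prod>c\<in>F. inverse (1 - fps_X ^ class_length c))"


section \<open>The hike monoid of the line digraph without backtracks\<close>

definition line_digraph_wb :: "'v pair_pre_digraph \<Rightarrow> ('v \<times> 'v) pair_pre_digraph" where
  "line_digraph_wb G = \<lparr> pverts = parcs G,
     parcs = {(e, f). e \<in> parcs G \<and> f \<in> parcs G \<and> snd e = fst f \<and> prod.swap e \<noteq> f} \<rparr>"

abbreviation hike_generators :: "'v pair_pre_digraph \<Rightarrow> (('v \<times> 'v) \<times> ('v \<times> 'v)) list set set" where
  "hike_generators G \<equiv> simple_classes (line_digraph_wb G)"

definition hike_independence ::
    "'v pair_pre_digraph \<Rightarrow> ((('v \<times> 'v) \<times> ('v \<times> 'v)) list set) rel" where
  "hike_independence G = {(h, k). h \<in> hike_generators G \<and> k \<in> hike_generators G \<and>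
     class_verts h \<inter> class_verts k = {}}"

definition elementary_swaps :: "'h set \<Rightarrow> 'h rel \<Rightarrow> 'h list rel" where
  "elementary_swaps S I =
     {(xs @ [a, b] @ ys, xs @ [b, a] @ ys) | xs a b ys. xs \<in> lists S \<and> ys \<in> lists S \<and> (a, b) \<in> I}"

text \<open>Independence is symmetric, so the reflexive transitive closure of the elementary swaps is
  already the congruence generated by them.\<close>

definition commutation_congruence :: "'h set \<Rightarrow> 'h rel \<Rightarrow> 'h list rel" where
  "commutation_congruence S I = (elementary_swaps S I)\<^sup>*"

definition hike_monoid ::
    "'v pair_pre_digraph \<Rightarrow> ((('v \<times> 'v) \<times> ('v \<times> 'v)) list set) list set monoid" where
  "hike_monoid G = (let R = commutation_congruence (hike_generators G) (hike_independence G) in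
     \<lparr> carrier = lists (hike_generators G) // R,
       mult = (\<lambda>X Y. \<Union>x\<in>X. \<Union>y\<in>Y. R `` {x @ y}),
       one = R `` {[]} \<rparr>)"

text \<open>Edges of the undirected noncommutation graph; a loop at \<open>h\<close> is the singleton \<open>{h}\<close>.\<close>

definition noncommutation_edges ::
    "'v pair_pre_digraph \<Rightarrow> (('v \<times> 'v) \<times> ('v \<times> 'v)) list set set set" where
  "noncommutation_edges G = {{h, k} | h k. h \<in> hike_generators G \<and> k \<in> hike_generators G \<and>
     (h, k) \<notin> hike_independence G}"


section \<open>Closures and their matrices\<close>

text \<open>\<open>is_closure V N K\<close>: the digraph \<open>K\<close> is a closure of the undirected graph with vertex set \<open>V\<close>
  and edge set \<open>N\<close>.\<close>

definition is_closure :: "'h set \<Rightarrow> 'h set set \<Rightarrow> 'h pair_pre_digraph \<Rightarrow> bool" where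
  "is_closure V N K \<longleftrightarrow>
     pverts K = V \<and> parcs K \<subseteq> V \<times> V \<and>
     (\<forall>h\<in>V. (h, h) \<in> parcs K) \<and>
     (\<forall>h\<in>V. \<forall>k\<in>V. h \<noteq> k \<and> {h, k} \<in> N \<longrightarrow> (h, k) \<in> parcs K \<and> (k, h) \<in> parcs K) \<and>
     (\<forall>h\<in>V. \<forall>k\<in>V. h \<noteq> k \<and> {h, k} \<notin> N \<longrightarrow>
        ((h, k) \<in> parcs K \<and> (k, h) \<notin> parcs K) \<or> ((h, k) \<notin> parcs K \<and> (k, h) \<in> parcs K)) \<and>
     (\<forall>s\<in>V. \<forall>t\<in>V. \<forall>u\<in>V. s \<noteq> t \<and> t \<noteq> u \<and> s \<noteq> u \<longrightarrow>
        ({s, t} \<in> N \<and> {s, u} \<notin> N \<and> {t, u} \<notin> N \<longrightarrow>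
           ((s, u) \<in> parcs K \<and> (t, u) \<in> parcs K) \<or> ((u, s) \<in> parcs K \<and> (u, t) \<in> parcs K)) \<and>
        ({s, t} \<notin> N \<and> {s, u} \<notin> N \<and> {t, u} \<notin> N \<longrightarrow>
           \<not> ((s, t) \<in> parcs K \<and> (t, u) \<in> parcs K \<and> (u, s) \<in> parcs K)))"

definition adjacency_matrix :: "nat \<Rightarrow> (nat \<Rightarrow> 'h) \<Rightarrow> 'h pair_pre_digraph \<Rightarrow> 'r::zero_neq_one mat" where
  "adjacency_matrix n h K = mat n n (\<lambda>(i, j). if (h i, h j) \<in> parcs K then 1 else 0)"

definition weight_matrix :: "nat \<Rightarrow> (nat \<Rightarrow> 'e list set) \<Rightarrow> rat fps mat" where
  "weight_matrix n h = mat_diag n (\<lambda>i. fps_X ^ class_length (h i))"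


section \<open>Sanity checks\<close>

lemma class_length_rotation:
  assumes "c \<in> A // rotation_rel" "C \<in> c"
  shows "class_length c = length C"
proof -
  have *: "\<And>C D. C \<in> c \<Longrightarrow> D \<in> c \<Longrightarrow> length C = length D"
    using assms(1) by (auto simp: quotient_def rotation_rel_def)
  show ?thesis unfolding class_length_def
    by (rule *[OF someI[of "\<lambda>C. C \<in> c"] assms(2)]) (rule assms(2))
qed

context includes fps_syntax
begin

lemma prod_nth_low:
  fixes f :: "'c \<Rightarrow> rat fps"
  assumes "finite F" "\<And>c k. c \<in> F \<Longrightarrow> k \<le> n \<Longrightarrow> f c $ k = (1 :: rat fps) $ k" "k \<le> n"
  shows "((\<Prod>c\<in>F. f c) * g) $ k = g $ k"
  using assms
proof (induction F arbitrary: k)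
  case empty
  then show ?case by simp
next
  case (insert x F)
  have "((\<Prod>c\<in>insert x F. f c) * g) $ k = (f x * ((\<Prod>c\<in>F. f c) * g)) $ k"
    using insert by (simp add: mult.assoc)
  also have "\<dots> = (\<Sum>i=0..k. f x $ i * ((\<Prod>c\<in>F. f c) * g) $ (k - i))"
    by (rule fps_mult_nth)
  also have "\<dots> = (\<Sum>i=0..k. (1 :: rat fps) $ i * g $ (k - i))"
  proof (rule sum.cong[OF refl])
    fix i assume "i \<in> {0..k}"
    then have "f x $ i = (1 :: rat fps) $ i" "((\<Prod>c\<in>F. f c) * g) $ (k - i) = g $ (k - i)"
      using insert by auto
    then show "f x $ i * ((\<Prod>c\<in>F. f c) * g) $ (k - i) = (1 :: rat fps) $ i * g $ (k - i)" by simp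
  qed
  also have "\<dots> = (1 * g) $ k" by (rule fps_mult_nth[symmetric])
  finally show ?case by simp
qed

lemma inverse_nth_low:
  assumes "k < l"
  shows "inverse (1 - fps_X ^ l :: rat fps) $ k = (1 :: rat fps) $ k"
proof -
  let ?p = "1 - fps_X ^ l :: rat fps"
  from assms have "?p $ 0 \<noteq> 0" by (simp add: fps_X_power_iff)
  then have "inverse ?p * ?p = 1" by (rule inverse_mult_eq_1)
  then have "inverse ?p = 1 + inverse ?p * fps_X ^ l" by (simp add: algebra_simps)
  then have "inverse ?p $ k = (1 + inverse ?p * fps_X ^ l) $ k" by (rule arg_cong)
  then show ?thesis using assms by (simp add: fps_X_power_mult_right_nth)
qed

end

lemma finite_prime_reduced_classes_length_le:
  assumes "finite (parcs G)"
  shows "finite {c \<in> prime_reduced_classes G. class_length c \<le> n}"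
proof -
  let ?L = "{C. set C \<subseteq> parcs G \<and> length C \<le> n}"
  have "{c \<in> prime_reduced_classes G. class_length c \<le> n} \<subseteq> (\<lambda>C. rotation_rel `` {C}) ` ?L"
  proof
    fix c assume c: "c \<in> {c \<in> prime_reduced_classes G. class_length c \<le> n}"
    then obtain C where C: "prime_cycle G C" "c = rotation_rel `` {C}"
      by (auto simp: prime_reduced_classes_def quotient_def)
    have "C \<in> c" unfolding C(2) rotation_rel_def by (auto intro: exI[of _ 0])
    then have "length C \<le> n"
      using c class_length_rotation unfolding prime_reduced_classes_def by fastforce
    moreover have "set C \<subseteq> parcs G"
      using C(1) by (auto simp: prime_cycle_def is_cycle_def pre_digraph.awalk_def)
    ultimately show "c \<in> (\<lambda>C. rotation_rel `` {C}) ` ?L" using C(2) by auto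
  qed
  then show ?thesis by (rule finite_subset) (intro finite_imageI finite_lists_length_le assms)
qed

lemma ihara_zeta_converges:
  assumes "finite (parcs G)"
  shows "((\<lambda>F. \<Prod>c\<in>F. inverse (1 - fps_X ^ class_length c)) \<longlongrightarrow> ihara_zeta G)
    (finite_subsets_at_top (prime_reduced_classes G))"
proof -
  let ?X = "prime_reduced_classes G"
  let ?f = "\<lambda>c :: ('a \<times> 'a) list set. inverse (1 - fps_X ^ class_length c) :: rat fps"
  let ?P = "\<lambda>F. \<Prod>c\<in>F. ?f c"
  let ?F = "\<lambda>n. {c \<in> ?X. class_length c \<le> n}"
  let ?a = "\<lambda>n. fps_nth (?P (?F n)) n"
  have "(?P \<longlongrightarrow> Abs_fps ?a) (finite_subsets_at_top ?X)"
  proof (rule tendsto_fpsI)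
    fix n
    have fin: "finite (?F n)" by (rule finite_prime_reduced_classes_length_le[OF assms])
    show "\<forall>\<^sub>F F in finite_subsets_at_top ?X. fps_nth (?P F) n = fps_nth (Abs_fps ?a) n"
      unfolding eventually_finite_subsets_at_top
    proof (intro exI[of _ "?F n"] conjI allI impI)
      fix F assume F: "finite F \<and> ?F n \<subseteq> F \<and> F \<subseteq> ?X"
      then have "?P F = ?P (F - ?F n) * ?P (?F n)"
        by (intro prod.subset_diff) auto
      also have "fps_nth \<dots> n = fps_nth (?P (?F n)) n"
      proof (rule prod_nth_low[of _ n])
        show "finite (F - ?F n)" using F by simp
        show "fps_nth (?f c) k = fps_nth 1 k" if "c \<in> F - ?F n" "k \<le> n" for c k
          using that F by (intro inverse_nth_low) auto
      qed simp
      finally show "fps_nth (?P F) n = fps_nth (Abs_fps ?a) n" by simp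
    qed (use fin in auto)
  qed
  moreover from this have "ihara_zeta G = Abs_fps ?a"
    unfolding ihara_zeta_def by (rule tendsto_Lim[OF finite_subsets_at_top_neq_bot])
  ultimately show ?thesis by (simp only:)
qed

lemma elementary_swaps_singleton: "([a], z) \<notin> elementary_swaps S I"
  by (simp add: elementary_swaps_def Cons_eq_append_conv)

lemma elementary_swaps_pair: "([a, b], z) \<in> elementary_swaps S I \<Longrightarrow> (a, b) \<in> I"
  unfolding elementary_swaps_def by (auto simp: Cons_eq_append_conv)

lemma elementary_swaps_pairI: "(a, b) \<in> I \<Longrightarrow> ([a, b], [b, a]) \<in> elementary_swaps S I"
  unfolding elementary_swaps_def
  by (intro CollectI exI[of _ "[]"] exI[of _ a] exI[of _ b]) simp

lemma commutation_congruence_singleton: "commutation_congruence S I `` {[a]} = {[a]}"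
proof -
  have "z = [a]" if "([a], z) \<in> (elementary_swaps S I)\<^sup>*" for z
    using that
  proof (rule converse_rtranclE)
    fix y assume "([a], y) \<in> elementary_swaps S I"
    with elementary_swaps_singleton show ?thesis by (rule notE)
  qed simp
  then show ?thesis unfolding commutation_congruence_def by blast
qed

lemma commutation_congruence_pair:
  assumes "sym I"
  shows "commutation_congruence S I `` {[a, b]} = commutation_congruence S I `` {[b, a]}
    \<longleftrightarrow> a = b \<or> (a, b) \<in> I" (is "?R `` _ = _ \<longleftrightarrow> _")
proof
  have "[b, a] \<in> ?R `` {[b, a]}" by (simp add: commutation_congruence_def)
  moreover assume "?R `` {[a, b]} = ?R `` {[b, a]}"
  ultimately have "([a, b], [b, a]) \<in> (elementary_swaps S I)\<^sup>*"
    unfolding commutation_congruence_def by blast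
  then show "a = b \<or> (a, b) \<in> I"
  proof (rule converse_rtranclE)
    assume "[a, b] = [b, a]"
    then have "hd [a, b] = hd [b, a]" by (rule arg_cong)
    then show ?thesis by simp
  next
    fix z assume "([a, b], z) \<in> elementary_swaps S I"
    then have "(a, b) \<in> I" by (rule elementary_swaps_pair)
    then show ?thesis ..
  qed
next
  assume "a = b \<or> (a, b) \<in> I"
  then show "?R `` {[a, b]} = ?R `` {[b, a]}"
  proof
    assume "(a, b) \<in> I"
    moreover from this have "(b, a) \<in> I" using assms by (rule symD[rotated])
    ultimately have "([a, b], [b, a]) \<in> ?R" "([b, a], [a, b]) \<in> ?R"
      unfolding commutation_congruence_def by (simp_all add: r_into_rtrancl elementary_swaps_pairI)
    moreover have "trans ?R" by (simp add: commutation_congruence_def trans_rtrancl)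
    ultimately show ?thesis by (blast dest: transD)
  qed simp
qed

text \<open>Two distinct generators commute in the hike monoid iff they are independent.\<close>

lemma hike_monoid_commute_iff:
  fixes G :: "'v pair_pre_digraph"
  defines "R \<equiv> commutation_congruence (hike_generators G) (hike_independence G)"
  shows "R `` {[h]} \<otimes>\<^bsub>hike_monoid G\<^esub> R `` {[k]} = R `` {[k]} \<otimes>\<^bsub>hike_monoid G\<^esub> R `` {[h]}
    \<longleftrightarrow> h = k \<or> (h, k) \<in> hike_independence G"
proof -
  have "sym (hike_independence G)" by (auto simp: hike_independence_def sym_def)
  moreover have "R `` {[a]} \<otimes>\<^bsub>hike_monoid G\<^esub> R `` {[b]} = R `` {[a, b]}" for a b
    by (simp add: hike_monoid_def Let_def R_def commutation_congruence_singleton)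
  ultimately show ?thesis by (simp add: R_def commutation_congruence_pair)
qed

end

theory Submission
  imports Defs
begin

text \<open>
  Both sides equal the sum of \<open>(-1)\<^sup>k u\<^sup>l\<close> over all sets of pairwise vertex-disjoint simple cycles of
  the line digraph without backtracks, where \<open>k\<close> is the number of cycles and \<open>l\<close> their total length.

  For the determinant, a closure is the complement of a strict partial order in which two cycles are
  comparable iff they commute. Hence the matrix is the product of a matrix that is unitriangular for
  this order with a rank-one perturbation of the identity, and its determinant is the signed sum over
  chains.

  For the zeta function, write \<open>P W\<close> for the above sum restricted to a vertex set \<open>W\<close>. Cancelling
  cycles through a vertex gives the adjugate-type identity \<open>P V * G\<^sub>v = P (V - {v})\<close>, where \<open>G\<^sub>v\<close>
  counts the closed walks at \<open>v\<close>. Summing over \<open>v\<close> yields \<open>- u P' = P N\<close> with \<open>N\<close> counting all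
  closed walks of positive length. Since every closed walk is a unique power of a prime one, the
  logarithmic derivative of the Euler product is \<open>N\<close> as well.
\<close>


section \<open>Clique polynomials\<close>

text \<open>The (signed) clique polynomial of the relation \<open>I\<close>: the Moebius function of the trace
  monoid with independence \<open>I\<close>.\<close>

definition indep_poly :: "('c \<Rightarrow> 'c \<Rightarrow> bool) \<Rightarrow> ('c \<Rightarrow> 'r::comm_ring_1) \<Rightarrow> 'c set \<Rightarrow> 'r" where
  "indep_poly I w U = (\<Sum>S | S \<subseteq> U \<and> pairwise I S. \<Prod>c\<in>S. - w c)"

lemma indep_poly_remove:
  assumes "finite U" "c \<in> U" "symp I"
  shows "indep_poly I w U = indep_poly I w (U - {c}) - w c * indep_poly I w {d \<in> U - {c}. I c d}"
proof -
  let ?A = "{S. S \<subseteq> U - {c} \<and> pairwise I S}"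
  let ?B = "{S. S \<subseteq> {d \<in> U - {c}. I c d} \<and> pairwise I S}"
  have fin: "finite ?A" "finite ?B"
    using assms(1) by (auto intro: finite_subset[of _ "Pow U"])
  have eq: "{S. S \<subseteq> U \<and> pairwise I S} = ?A \<union> insert c ` ?B"
  proof (intro equalityI subsetI)
    fix S assume S: "S \<in> {S. S \<subseteq> U \<and> pairwise I S}"
    show "S \<in> ?A \<union> insert c ` ?B"
    proof (cases "c \<in> S")
      case True
      then have "S = insert c (S - {c})" by auto
      moreover have "S - {c} \<in> ?B"
        using S True by (auto simp: pairwise_def)
      ultimately show ?thesis by blast
    qed (use S in auto)
  next
    fix S assume "S \<in> ?A \<union> insert c ` ?B"
    then show "S \<in> {S. S \<subseteq> U \<and> pairwise I S}"
      using assms(2) sympD[OF assms(3)] by (fastforce simp: pairwise_insert)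
  qed
  have inj: "inj_on (insert c) ?B"
    unfolding inj_on_def by (blast dest: insert_ident[THEN iffD1, rotated 2])
  have "indep_poly I w U = indep_poly I w (U - {c}) + (\<Sum>S\<in>insert c ` ?B. \<Prod>d\<in>S. - w d)"
    unfolding indep_poly_def eq using fin by (intro sum.union_disjoint) auto
  also have "(\<Sum>S\<in>insert c ` ?B. \<Prod>d\<in>S. - w d) = (\<Sum>S\<in>?B. - w c * (\<Prod>d\<in>S. - w d))"
    unfolding sum.reindex[OF inj] o_def
  proof (rule sum.cong[OF refl])
    fix S assume "S \<in> ?B"
    then have "finite S" "c \<notin> S" using assms(1) by (auto dest: finite_subset)
    then show "(\<Prod>d\<in>insert c S. - w d) = - w c * (\<Prod>d\<in>S. - w d)" by simp
  qed
  also have "\<dots> = - (w c * indep_poly I w {d \<in> U - {c}. I c d})"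
    by (simp add: indep_poly_def sum_distrib_left sum_negf)
  finally show ?thesis by simp
qed

lemma indep_poly_remove_clique:
  assumes U: "finite U" and I: "symp I"
    and K: "K \<subseteq> U" "\<And>c d. c \<in> K \<Longrightarrow> d \<in> K \<Longrightarrow> c \<noteq> d \<Longrightarrow> \<not> I c d"
  shows "indep_poly I w U =
    indep_poly I w (U - K) - (\<Sum>c\<in>K. w c * indep_poly I w {d \<in> U - K. I c d})"
proof -
  have "finite K" using U K(1) by (rule rev_finite_subset)
  then show ?thesis using K
  proof (induction K rule: finite_induct)
    case (insert c K)
    have eq: "{d \<in> U - K. I e d} = {d \<in> U - insert c K. I e d}" if "e \<in> K" for e
      using insert.hyps(2) insert.prems(2)[of e c] that by auto
    have "indep_poly I w U =
      indep_poly I w (U - K) - (\<Sum>e\<in>K. w e * indep_poly I w {d \<in> U - K. I e d})"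
      using insert by auto
    also have "indep_poly I w (U - K) =
      indep_poly I w (U - K - {c}) - w c * indep_poly I w {d \<in> U - K - {c}. I c d}"
      using insert.hyps insert.prems(1) U I by (intro indep_poly_remove) auto
    also have "U - K - {c} = U - insert c K" by auto
    finally show ?case
      using insert.hyps eq by (simp add: algebra_simps)
  qed simp
qed

lemma indep_poly_reindex:
  assumes h: "bij_betw h A U"
    and I: "\<And>i j. i \<in> A \<Longrightarrow> j \<in> A \<Longrightarrow> i \<noteq> j \<Longrightarrow> J i j \<longleftrightarrow> I (h i) (h j)"
  shows "indep_poly I w U = indep_poly J (\<lambda>i. w (h i)) A"
  unfolding indep_poly_def
proof (rule sum.reindex_bij_betw[symmetric, THEN trans])
  have inj: "inj_on h A" and U: "U = h ` A" using h by (auto simp: bij_betw_def)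
  have pw: "pairwise I (h ` S) \<longleftrightarrow> pairwise J S" if "S \<subseteq> A" for S
  proof -
    have "h i = h j \<longleftrightarrow> i = j" "i \<noteq> j \<Longrightarrow> J i j \<longleftrightarrow> I (h i) (h j)" if "i \<in> S" "j \<in> S" for i j
      using I[of i j] inj_on_eq_iff[OF inj, of i j] subsetD[OF \<open>S \<subseteq> A\<close>] that by simp_all
    then show ?thesis unfolding pairwise_image by (auto simp: pairwise_def)
  qed
  show "bij_betw ((`) h) {S. S \<subseteq> A \<and> pairwise J S} {S. S \<subseteq> U \<and> pairwise I S}"
    unfolding bij_betw_def
  proof
    show "inj_on ((`) h) {S. S \<subseteq> A \<and> pairwise J S}"
      using inj_on_image_Pow[OF inj] by (rule inj_on_subset) auto
    show "(`) h ` {S. S \<subseteq> A \<and> pairwise J S} = {S. S \<subseteq> U \<and> pairwise I S}"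
      using pw unfolding U by (auto simp: subset_image_iff)
  qed
  show "(\<Sum>S | S \<subseteq> A \<and> pairwise J S. \<Prod>c\<in>h ` S. - w c) =
    (\<Sum>S | S \<subseteq> A \<and> pairwise J S. \<Prod>i\<in>S. - w (h i))"
    using inj by (intro sum.cong refl, subst prod.reindex) (auto dest: inj_on_subset)
qed

lemma indep_poly_poset:
  assumes "finite U" "irreflp_on U L" "transp_on U L"
    and "symp I" "\<And>i j. i \<in> U \<Longrightarrow> j \<in> U \<Longrightarrow> i \<noteq> j \<Longrightarrow> I i j \<longleftrightarrow> L i j \<or> L j i"
  shows "indep_poly I w U = 1 - (\<Sum>j\<in>U. w j * indep_poly I w {k \<in> U. L k j})"
  using assms
proof (induction "card U" arbitrary: U)
  case 0
  then have "{S. S \<subseteq> U \<and> pairwise I S} = {{}}" by (auto simp: pairwise_def)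
  with 0 show ?case by (simp add: indep_poly_def)
next
  case (Suc m)
  have "asymp_on U L"
    using Suc.prems(2,3) by (auto intro!: asymp_onI dest: transp_onD irreflp_onD)
  moreover have "U \<noteq> {}" using Suc.hyps(2) by auto
  ultimately obtain c where c: "c \<in> U" and max: "\<And>x. x \<in> U \<Longrightarrow> x \<noteq> c \<Longrightarrow> \<not> L c x"
    using Finite_Set.bex_max_element[OF Suc.prems(1) _ Suc.prems(3)] by metis
  have L: "{k \<in> U - {c}. L k j} = {k \<in> U. L k j}" if "j \<in> U - {c}" for j
    using max that by auto
  have Lc: "{d \<in> U - {c}. I c d} = {k \<in> U. L k c}"
    using max c Suc.prems(2,5) by (auto dest: irreflp_onD)
  have "indep_poly I w U = indep_poly I w (U - {c}) - w c * indep_poly I w {k \<in> U. L k c}"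
    using indep_poly_remove[OF Suc.prems(1) c Suc.prems(4), of w] Lc by simp
  also have "indep_poly I w (U - {c}) =
    1 - (\<Sum>j\<in>U - {c}. w j * indep_poly I w {k \<in> U - {c}. L k j})"
    using Suc c by (intro Suc.hyps) (auto intro: transp_on_subset irreflp_on_subset)
  also have "(\<Sum>j\<in>U - {c}. w j * indep_poly I w {k \<in> U - {c}. L k j}) =
    (\<Sum>j\<in>U - {c}. w j * indep_poly I w {k \<in> U. L k j})"
    using L by (intro sum.cong) auto
  finally show ?case
    using Suc.prems(1) c by (simp add: sum.remove algebra_simps)
qed

lemma fps_X_mult_deriv_prod_fps_X_power:
  fixes k :: "'c \<Rightarrow> nat"
  shows "fps_X * fps_deriv (\<Prod>c\<in>S. - (fps_X ^ k c) :: ('r::comm_ring_1) fps) =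
    of_nat (sum k S) * (\<Prod>c\<in>S. - (fps_X ^ k c))"
proof -
  have eq: "(\<Prod>c\<in>S. - (fps_X ^ k c) :: 'r fps) = fps_const ((-1) ^ card S) * fps_X ^ sum k S"
    by (simp add: prod_uminus power_sum flip: fps_const_power fps_const_neg)
  have "fps_X * fps_deriv (fps_X ^ n) = of_nat n * (fps_X ^ n :: 'r fps)" for n
    by (induction n) (simp_all add: algebra_simps)
  then have "fps_X * (a * fps_deriv (fps_X ^ n)) = of_nat n * (a * fps_X ^ n :: 'r fps)" for a n
    by (metis mult.left_commute)
  then show ?thesis unfolding eq by (simp del: of_nat_sum)
qed

lemma fps_X_mult_deriv_indep_poly:
  fixes vs :: "'c \<Rightarrow> 'v set"
  defines "Ip \<equiv> indep_poly (\<lambda>c d. vs c \<inter> vs d = {}) (\<lambda>c. fps_X ^ card (vs c) :: ('r::comm_ring_1) fps)"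
  assumes "finite U" "finite A" "\<And>c. c \<in> U \<Longrightarrow> vs c \<subseteq> A"
  shows "fps_X * fps_deriv (Ip U) = (\<Sum>v\<in>A. Ip U - Ip {c \<in> U. v \<notin> vs c})"
proof -
  let ?T = "{S. S \<subseteq> U \<and> pairwise (\<lambda>c d. vs c \<inter> vs d = {}) S}"
  let ?t = "\<lambda>S. \<Prod>c\<in>S. - (fps_X ^ card (vs c)) :: 'r fps"
  have fin: "finite ?T" using assms(2) by (auto intro: finite_subset[of _ "Pow U"])
  have Ip: "Ip U = sum ?t ?T" by (simp add: Ip_def indep_poly_def)
  have "Ip {c \<in> U. v \<notin> vs c} = (\<Sum>S\<in>?T. if v \<in> \<Union> (vs ` S) then 0 else ?t S)" for v
    unfolding Ip_def indep_poly_def using fin by (intro sum.mono_neutral_cong_left) auto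
  then have "(\<Sum>v\<in>A. Ip U - Ip {c \<in> U. v \<notin> vs c}) =
    (\<Sum>v\<in>A. \<Sum>S\<in>?T. if v \<in> \<Union> (vs ` S) then ?t S else 0)"
    unfolding Ip by (auto simp flip: sum_subtractf intro!: sum.cong)
  also have "\<dots> = (\<Sum>S\<in>?T. \<Sum>v\<in>A. if v \<in> \<Union> (vs ` S) then ?t S else 0)"
    by (rule sum.swap)
  also have "\<dots> = (\<Sum>S\<in>?T. of_nat (\<Sum>c\<in>S. card (vs c)) * ?t S)"
  proof (rule sum.cong[OF refl])
    fix S assume S: "S \<in> ?T"
    then have sub: "\<Union> (vs ` S) \<subseteq> A" using assms(4) by auto
    have "(\<Sum>v\<in>A. if v \<in> \<Union> (vs ` S) then ?t S else 0) = (\<Sum>v\<in>\<Union> (vs ` S). ?t S)"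
      using sub assms(3) by (intro sum.mono_neutral_cong_right) auto
    also have "\<dots> = of_nat (card (\<Union> (vs ` S))) * ?t S" by simp
    also have "card (\<Union> (vs ` S)) = (\<Sum>c\<in>S. card (vs c))"
    proof (rule card_UN_disjoint)
      show "finite S" using S assms(2) by (auto dest: finite_subset)
      show "\<forall>c\<in>S. finite (vs c)" using S assms(3,4) by (auto dest: finite_subset)
      show "\<forall>c\<in>S. \<forall>d\<in>S. c \<noteq> d \<longrightarrow> vs c \<inter> vs d = {}"
        using S by (simp add: pairwise_def)
    qed
    finally show "(\<Sum>v\<in>A. if v \<in> \<Union> (vs ` S) then ?t S else 0) =
      of_nat (\<Sum>c\<in>S. card (vs c)) * ?t S" .
  qed
  also have "\<dots> = fps_X * fps_deriv (Ip U)"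
    by (simp add: Ip fps_deriv_sum sum_distrib_left fps_X_mult_deriv_prod_fps_X_power)
  finally show ?thesis ..
qed


section \<open>Determinants over partial orders\<close>

lemma det_one_minus_rank_one:
  fixes x :: "nat \<Rightarrow> 'r::idom"
  shows "det (mat n n (\<lambda>(i, j). (if i = j then 1 else 0) - x i)) = 1 - (\<Sum>i<n. x i)"
proof -
  \<comment> \<open>Weinstein--Aronszajn: factor the bordered matrix with blocks \<open>1, ?o, ?x, 1\<^sub>m n\<close> in both
    block-triangular ways.\<close>
  let ?o = "mat 1 n (\<lambda>_. 1) :: 'r mat"
  let ?x = "mat n 1 (\<lambda>(i, _). x i)"
  let ?R = "mat n n (\<lambda>(i, j). (if i = j then 1 else 0) - x i)"
  let ?s = "mat 1 1 (\<lambda>_. 1 - (\<Sum>i<n. x i))"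
  have ox: "?o * ?x = mat 1 1 (\<lambda>_. \<Sum>i<n. x i)"
    by (intro eq_matI) (auto simp: scalar_prod_def atLeast0LessThan)
  have xo: "?x * ?o = mat n n (\<lambda>(i, j). x i)"
    by (intro eq_matI) (auto simp: scalar_prod_def)
  have "det ?R = det (four_block_mat (1\<^sub>m 1) ?o (0\<^sub>m n 1) ?R)"
    by (subst det_four_block_mat_lower_left_zero[of _ 1 _ n]) auto
  also have "\<dots> = det (four_block_mat (1\<^sub>m 1) (0\<^sub>m 1 n) ?x (1\<^sub>m n)) *
      det (four_block_mat (1\<^sub>m 1) ?o (0\<^sub>m n 1) ?R)"
    by (subst det_four_block_mat_upper_right_zero[of _ 1 _ n]) auto
  also have "\<dots> = det (four_block_mat (1\<^sub>m 1) (0\<^sub>m 1 n) ?x (1\<^sub>m n) *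
      four_block_mat (1\<^sub>m 1) ?o (0\<^sub>m n 1) ?R)"
    by (rule det_mult[symmetric, of _ "1 + n"]) auto
  also have "four_block_mat (1\<^sub>m 1) (0\<^sub>m 1 n) ?x (1\<^sub>m n) * four_block_mat (1\<^sub>m 1) ?o (0\<^sub>m n 1) ?R =
      four_block_mat (1\<^sub>m 1) ?o ?x (1\<^sub>m n)"
  proof -
    have "1\<^sub>m 1 * 1\<^sub>m 1 + 0\<^sub>m 1 n * 0\<^sub>m n 1 = (1\<^sub>m 1 :: 'r mat)" by simp
    moreover have "1\<^sub>m 1 * ?o + 0\<^sub>m 1 n * ?R = ?o" by simp
    moreover have "?x * 1\<^sub>m 1 + 1\<^sub>m n * 0\<^sub>m n 1 = ?x" by simp
    moreover have "?x * ?o + 1\<^sub>m n * ?R = 1\<^sub>m n"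
      unfolding xo by (rule eq_matI) auto
    ultimately show ?thesis
      by (subst mult_four_block_mat[of _ 1 1 _ n _ n _ _ 1 _ n]) (simp_all del: One_nat_def)
  qed
  also have "\<dots> = four_block_mat ?s ?o (0\<^sub>m n 1) (1\<^sub>m n) * four_block_mat (1\<^sub>m 1) (0\<^sub>m 1 n) ?x (1\<^sub>m n)"
  proof -
    have "?s * 1\<^sub>m 1 + ?o * ?x = 1\<^sub>m 1"
      unfolding ox by (rule eq_matI) auto
    moreover have "?s * 0\<^sub>m 1 n + ?o * 1\<^sub>m n = ?o" by simp
    moreover have "0\<^sub>m n 1 * 1\<^sub>m 1 + 1\<^sub>m n * ?x = ?x" by simp
    moreover have "0\<^sub>m n 1 * 0\<^sub>m 1 n + 1\<^sub>m n * 1\<^sub>m n = (1\<^sub>m n :: 'r mat)" by simp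
    ultimately show ?thesis
      by (subst mult_four_block_mat[of _ 1 1 _ n _ n _ _ 1 _ n]) (simp_all del: One_nat_def)
  qed
  also have "det \<dots> = det (four_block_mat ?s ?o (0\<^sub>m n 1) (1\<^sub>m n)) *
      det (four_block_mat (1\<^sub>m 1) (0\<^sub>m 1 n) ?x (1\<^sub>m n))"
    by (rule det_mult[of _ "1 + n"]) auto
  also have "det (four_block_mat ?s ?o (0\<^sub>m n 1) (1\<^sub>m n)) = det ?s"
    by (subst det_four_block_mat_lower_left_zero[of _ 1 _ n]) auto
  also have "det (four_block_mat (1\<^sub>m 1) (0\<^sub>m 1 n) ?x (1\<^sub>m n)) = 1"
    by (subst det_four_block_mat_upper_right_zero[of _ 1 _ n]) auto
  also have "det ?s * 1 = det ?s" by simp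
  also have "\<dots> = 1 - (\<Sum>i<n. x i)" by (simp add: det_single)
  finally show ?thesis .
qed

lemma det_unitriangular_poset:
  fixes a :: "nat \<Rightarrow> nat \<Rightarrow> 'r::comm_ring_1"
  assumes "irreflp_on {..<n} L" "transp_on {..<n} L"
  shows "det (mat n n (\<lambda>(i, j). if i = j then 1 else if L j i then a i j else 0)) = 1"
    (is "det ?N = 1")
proof -
  have id: "p = id" if p: "p permutes {0..<n}" and le: "\<And>i. i < n \<Longrightarrow> p i = i \<or> L (p i) i" for p
  proof -
    let ?L = "{(j, i). j < n \<and> i < n \<and> L j i}"
    have "trans ?L" using assms(2) by (auto simp: trans_def dest: transp_onD)
    moreover have "finite ?L" by (rule finite_subset[of _ "{..<n} \<times> {..<n}"]) auto
    moreover have "irrefl ?L" using assms(1) by (auto simp: irrefl_def dest: irreflp_onD)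
    ultimately have "wf ?L" by (simp add: finite_acyclic_wf acyclic_irrefl)
    then have "i < n \<longrightarrow> p i = i" for i
    proof (induction i rule: wf_induct_rule)
      case (less i)
      show ?case
      proof
        assume i: "i < n"
        moreover have "p i < n" using i permutes_in_image[OF p, of i] by simp
        ultimately have "p i = i \<or> p (p i) = p i" using le[OF i] less by auto
        then show "p i = i" using permutes_inj[OF p] by (auto dest: injD)
      qed
    qed
    moreover have "p i = i" if "\<not> i < n" for i using permutes_not_in[OF p, of i] that by simp
    ultimately show ?thesis by (auto simp: fun_eq_iff)
  qed
  have "det ?N = (\<Sum>p | p permutes {0..<n}. signof p * (\<Prod>i = 0..<n. ?N $$ (i, p i)))"
    by (rule det_def') auto
  also have "\<dots> = (\<Sum>p\<in>{id}. signof p * (\<Prod>i = 0..<n. ?N $$ (i, p i)))"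
  proof (rule sum.mono_neutral_right)
    show "\<forall>p\<in>{p. p permutes {0..<n}} - {id}. signof p * (\<Prod>i = 0..<n. ?N $$ (i, p i)) = 0"
    proof
      fix p assume p: "p \<in> {p. p permutes {0..<n}} - {id}"
      then obtain i where "i < n" "p i \<noteq> i" "\<not> L (p i) i" using id by blast
      moreover from this p have "p i < n" using permutes_in_image[of p "{0..<n}" i] by simp
      ultimately have "?N $$ (i, p i) = 0" by simp
      with \<open>i < n\<close> have "(\<Prod>i = 0..<n. ?N $$ (i, p i)) = 0" by (intro prod_zero) auto
      then show "signof p * (\<Prod>i = 0..<n. ?N $$ (i, p i)) = 0" by simp
    qed
  qed (auto simp: finite_permutations permutes_id)
  also have "\<dots> = 1" by simp
  finally show ?thesis .
qed

lemma det_poset_eq_indep_poly: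
  fixes w :: "nat \<Rightarrow> 'r::idom"
  assumes "irreflp_on {..<n} L" "transp_on {..<n} L"
  shows "det (mat n n (\<lambda>(i, j). (if i = j then 1 else 0) - w i * (if L j i then 0 else 1))) =
    indep_poly (\<lambda>i j. L i j \<or> L j i) w {..<n}" (is "det ?M = indep_poly ?I w _")
proof -
  define x where "x i = w i * indep_poly ?I w {k \<in> {..<n}. L k i}" for i
  let ?N = "mat n n (\<lambda>(i, j). if i = j then 1 else if L j i then w i else 0)"
  let ?R = "mat n n (\<lambda>(i, j). (if i = j then 1 else 0) - x i)"
  have x: "x i + w i * (\<Sum>k | k < n \<and> L k i. x k) = w i" if i: "i < n" for i
  proof -
    let ?D = "{k \<in> {..<n}. L k i}"
    have "indep_poly ?I w ?D = 1 - (\<Sum>j\<in>?D. w j * indep_poly ?I w {k \<in> ?D. L k j})"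
      using assms
      by (intro indep_poly_poset) (auto intro: irreflp_on_subset transp_on_subset sympI)
    also have "(\<Sum>j\<in>?D. w j * indep_poly ?I w {k \<in> ?D. L k j}) = (\<Sum>j\<in>?D. x j)"
    proof (rule sum.cong[OF refl])
      fix j assume "j \<in> ?D"
      then have "{k \<in> ?D. L k j} = {k \<in> {..<n}. L k j}"
        using i transp_onD[OF assms(2)] by auto
      then show "w j * indep_poly ?I w {k \<in> ?D. L k j} = x j" by (simp add: x_def)
    qed
    finally have "indep_poly ?I w ?D = 1 - (\<Sum>j\<in>?D. x j)" .
    then show ?thesis by (simp add: x_def[of i] right_diff_distrib)
  qed
  \<comment> \<open>\<open>x\<close> solves \<open>?N x = w\<close>, so the rank-one part of \<open>?M\<close> can be split off as a right factor.\<close>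
  have "?M = ?N * ?R"
  proof (rule eq_matI)
    fix i j assume "i < dim_row (?N * ?R)" "j < dim_col (?N * ?R)"
    then have ij: "i < n" "j < n" by auto
    let ?a = "\<lambda>k. if i = k then 1 else if L k i then w i else 0"
    have "(?N * ?R) $$ (i, j) = (\<Sum>k<n. ?a k * ((if k = j then 1 else 0) - x k))"
      using ij by (simp add: scalar_prod_def atLeast0LessThan)
    also have "\<dots> = (\<Sum>k<n. if k = j then ?a k else 0) - (\<Sum>k<n. ?a k * x k)"
      unfolding sum_subtractf[symmetric] by (intro sum.cong) (auto simp: algebra_simps)
    also have "(\<Sum>k<n. if k = j then ?a k else 0) = ?a j" using ij by simp
    also have "(\<Sum>k<n. ?a k * x k) =
      (\<Sum>k<n. (if k = i then x k else 0) + (if L k i then w i * x k else 0))"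
      using irreflp_onD[OF assms(1)] ij by (intro sum.cong) auto
    also have "\<dots> = x i + w i * (\<Sum>k | k < n \<and> L k i. x k)"
      using ij by (simp add: sum.distrib sum_distrib_left flip: sum.inter_filter)
    also have "\<dots> = w i" by (rule x[OF ij(1)])
    finally show "?M $$ (i, j) = (?N * ?R) $$ (i, j)"
      using ij irreflp_onD[OF assms(1), of i] by auto
  qed auto
  then have "det ?M = det ?N * det ?R" by (simp add: det_mult[of _ n])
  also have "\<dots> = 1 - (\<Sum>i<n. x i)"
    by (simp add: det_unitriangular_poset[OF assms] det_one_minus_rank_one)
  also have "\<dots> = indep_poly ?I w {..<n}"
    using assms by (subst indep_poly_poset[of "{..<n}" L]) (auto simp: x_def intro: sympI)
  finally show ?thesis .
qed


section \<open>Simple paths and walks\<close>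

lemma successively_rotate:
  "successively P (q @ v # p) \<and> P v (hd (q @ v # p)) \<longleftrightarrow>
    successively P (v # q) \<and> P (last (v # q)) v \<and> successively P p \<and> (p = [] \<or> P v (hd p))"
  by (cases q) (auto simp: successively_append_iff successively_Cons)

definition simple_paths :: "'a rel \<Rightarrow> 'a set \<Rightarrow> 'a \<Rightarrow> 'a \<Rightarrow> 'a list set" where
  "simple_paths E W x y = {p. p \<noteq> [] \<and> hd p = x \<and> last p = y \<and> distinct p \<and> set p \<subseteq> W \<and>
     successively (\<lambda>a b. (a, b) \<in> E) p}"

definition simple_cycles_at :: "'a rel \<Rightarrow> 'a set \<Rightarrow> 'a \<Rightarrow> 'a list set" where
  "simple_cycles_at E W v = {p. p \<noteq> [] \<and> hd p = v \<and> distinct p \<and> set p \<subseteq> W \<and>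
     successively (\<lambda>a b. (a, b) \<in> E) p \<and> (last p, v) \<in> E}"

text \<open>\<open>length p\<close> counts vertices, so \<open>path_sum\<close> carries one factor \<open>fps_X\<close> more than the
  corresponding entry of the adjugate of \<open>1 - u A\<close>.\<close>

definition path_sum :: "'a rel \<Rightarrow> ('a set \<Rightarrow> 'r::comm_ring_1 fps) \<Rightarrow> 'a set \<Rightarrow> 'a \<Rightarrow> 'a \<Rightarrow> 'r fps" where
  "path_sum E Q W x y = (\<Sum>p\<in>simple_paths E W x y. fps_X ^ length p * Q (W - set p))"

lemma finite_simple_paths: "finite W \<Longrightarrow> finite (simple_paths E W x y)"
  by (rule finite_subset[OF _ finite_subset_distinct]) (auto simp: simple_paths_def)

lemma finite_simple_cycles_at: "finite W \<Longrightarrow> finite (simple_cycles_at E W v)"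
  by (rule finite_subset[OF _ finite_subset_distinct]) (auto simp: simple_cycles_at_def)

lemma simple_paths_same: "v \<in> W \<Longrightarrow> simple_paths E W v v = {[v]}"
proof -
  have "p = [v]" if "p \<in> simple_paths E W v v" for p
    using that unfolding simple_paths_def by (cases p) (auto split: if_splits)
  then show "v \<in> W \<Longrightarrow> ?thesis" by (auto simp: simple_paths_def)
qed

lemma simple_paths_Cons:
  assumes "v \<noteq> w" "v \<in> W"
  shows "simple_paths E W v w = (\<Union>x\<in>E `` {v}. (#) v ` simple_paths E (W - {v}) x w)"
proof (intro equalityI subsetI)
  fix p assume "p \<in> simple_paths E W v w"
  then obtain q where "p = v # q" "q \<noteq> []" "(v, hd q) \<in> E" "q \<in> simple_paths E (W - {v}) (hd q) w"
    using assms unfolding simple_paths_def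
    by (cases p) (auto simp: successively_Cons split: if_splits)
  then show "p \<in> (\<Union>x\<in>E `` {v}. (#) v ` simple_paths E (W - {v}) x w)" by auto
qed (use assms in \<open>auto simp: simple_paths_def successively_Cons\<close>)

lemma simple_paths_avoiding:
  "simple_paths E (W - {v}) x w = {p \<in> simple_paths E W x w. v \<notin> set p}"
  by (auto simp: simple_paths_def)

lemma sum_simple_paths_UN:
  assumes "finite W" "finite E"
  shows "(\<Sum>x\<in>E `` {v}. sum f (simple_paths E W x w)) =
    sum f (\<Union>x\<in>E `` {v}. simple_paths E W x w)"
proof (rule sum.UNION_disjoint[symmetric])
  show "\<forall>x\<in>E `` {v}. \<forall>y\<in>E `` {v}. x \<noteq> y \<longrightarrow> simple_paths E W x w \<inter> simple_paths E W y w = {}"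
    by (auto simp: simple_paths_def)
qed (use assms in \<open>auto simp: finite_simple_paths intro: finite_Image\<close>)

lemma path_sum_step:
  fixes Q :: "'a set \<Rightarrow> 'r::comm_ring_1 fps"
  assumes E: "finite E" and W: "finite W" "v \<in> W"
    and Q: "\<And>U v. U \<subseteq> W \<Longrightarrow> v \<in> U \<Longrightarrow>
      Q U = Q (U - {v}) - (\<Sum>p\<in>simple_cycles_at E U v. fps_X ^ length p * Q (U - set p))"
  shows "path_sum E Q W v w =
    fps_X * ((if v = w then Q W else 0) + (\<Sum>x\<in>E `` {v}. path_sum E Q W x w))"
proof (cases "v = w")
  case True
  let ?S = "\<Union>x\<in>E `` {v}. simple_paths E W x v"
  have "(\<Sum>x\<in>E `` {v}. path_sum E Q W x v) = (\<Sum>p\<in>?S. fps_X ^ length p * Q (W - set p))"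
    unfolding path_sum_def by (rule sum_simple_paths_UN[OF W(1) E])
  also have "\<dots> = (\<Sum>c\<in>simple_cycles_at E W v. fps_X ^ length c * Q (W - set c))"
  proof (rule sum.reindex_bij_witness[of _ rotate1 "\<lambda>p. last p # butlast p"])
    fix p assume "p \<in> ?S"
    then obtain q where p: "p = q @ [v]" and q: "(v, hd (q @ [v])) \<in> E" "distinct (q @ [v])"
      "set (q @ [v]) \<subseteq> W" "successively (\<lambda>a b. (a, b) \<in> E) (q @ [v])"
      unfolding simple_paths_def by (cases p rule: rev_cases) auto
    show "rotate1 (last p # butlast p) = p" by (simp add: p)
    have "successively (\<lambda>a b. (a, b) \<in> E) (v # q)" "(last (v # q), v) \<in> E"
      using q successively_rotate[of "\<lambda>a b. (a, b) \<in> E" q v "[]"] by simp_all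
    then show "last p # butlast p \<in> simple_cycles_at E W v"
      using q by (auto simp: p simple_cycles_at_def)
    show "fps_X ^ length (last p # butlast p) * Q (W - set (last p # butlast p)) =
      fps_X ^ length p * Q (W - set p)" by (simp add: p)
  next
    fix c assume "c \<in> simple_cycles_at E W v"
    then obtain q where c: "c = v # q" and q: "(last (v # q), v) \<in> E" "distinct (v # q)"
      "set (v # q) \<subseteq> W" "successively (\<lambda>a b. (a, b) \<in> E) (v # q)"
      unfolding simple_cycles_at_def by (cases c) auto
    show "last (rotate1 c) # butlast (rotate1 c) = c" by (simp add: c)
    have "successively (\<lambda>a b. (a, b) \<in> E) (q @ [v])" "(v, hd (q @ [v])) \<in> E"
      using q successively_rotate[of "\<lambda>a b. (a, b) \<in> E" q v "[]"] by simp_all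
    then show "rotate1 c \<in> ?S"
      using q by (auto simp: c simple_paths_def)
  qed
  also have "\<dots> = Q (W - {v}) - Q W" using Q[OF order_refl W(2)] by simp
  finally show ?thesis
    using True W(2) by (simp add: path_sum_def simple_paths_same)
next
  case False
  let ?t = "\<lambda>p. fps_X ^ length p * Q (W - set p)"
  let ?T = "\<Union>x\<in>E `` {v}. simple_paths E W x w"
  let ?T1 = "\<Union>x\<in>E `` {v}. simple_paths E (W - {v}) x w"
  have fin: "finite ?T" "finite ?T1" using E W by (auto simp: finite_simple_paths intro!: finite_Image)
  have T1: "?T1 = {p \<in> ?T. v \<notin> set p}" by (auto simp: simple_paths_avoiding)
  have "(\<Sum>p\<in>?T1. ?t p) = (\<Sum>p\<in>?T1. fps_X ^ length p * Q (W - {v} - set p)) -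
    (\<Sum>p\<in>?T1. \<Sum>c\<in>simple_cycles_at E (W - set p) v. fps_X ^ (length p + length c) * Q (W - set p - set c))"
    unfolding sum_subtractf[symmetric]
  proof (rule sum.cong[OF refl])
    fix p assume "p \<in> ?T1"
    then have "v \<in> W - set p" using W(2) T1 by auto
    moreover have "W - set p - {v} = W - {v} - set p" by auto
    ultimately have "Q (W - set p) = Q (W - {v} - set p) -
        (\<Sum>c\<in>simple_cycles_at E (W - set p) v. fps_X ^ length c * Q (W - set p - set c))"
      using Q[of "W - set p" v] by simp
    then show "?t p = fps_X ^ length p * Q (W - {v} - set p) -
        (\<Sum>c\<in>simple_cycles_at E (W - set p) v. fps_X ^ (length p + length c) * Q (W - set p - set c))"
      by (simp add: right_diff_distrib sum_distrib_left power_add mult.assoc)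
  qed
  also have "(\<Sum>p\<in>?T1. \<Sum>c\<in>simple_cycles_at E (W - set p) v. fps_X ^ (length p + length c) * Q (W - set p - set c)) =
    (\<Sum>(p, c)\<in>(SIGMA p:?T1. simple_cycles_at E (W - set p) v).
      fps_X ^ (length p + length c) * Q (W - set p - set c))"
    using fin W(1) by (intro sum.Sigma) (auto simp: finite_simple_cycles_at)
  \<comment> \<open>A path through \<open>v\<close> starting at a successor of \<open>v\<close> is a cycle at \<open>v\<close> followed by a path
    from another successor that avoids \<open>v\<close>; this cancels the two kinds of terms.\<close>
  also have "\<dots> = (\<Sum>p | p \<in> ?T \<and> v \<in> set p. ?t p)"
  proof (rule sum.reindex_bij_witness[of _
      "\<lambda>p. (tl (dropWhile (\<lambda>a. a \<noteq> v) p), v # takeWhile (\<lambda>a. a \<noteq> v) p)" "\<lambda>(p, c). rotate1 c @ p"])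
    fix pc assume "pc \<in> (SIGMA p:?T1. simple_cycles_at E (W - set p) v)"
    then obtain p c where pc: "pc = (p, c)" and p: "p \<noteq> []" "(v, hd p) \<in> E" "last p = w"
      "distinct p" "set p \<subseteq> W - {v}" "successively (\<lambda>a b. (a, b) \<in> E) p"
      and "c \<in> simple_cycles_at E (W - set p) v"
      unfolding simple_paths_def by auto
    then obtain q where c: "c = v # q" and q: "(last (v # q), v) \<in> E" "distinct (v # q)"
      "set (v # q) \<subseteq> W - set p" "successively (\<lambda>a b. (a, b) \<in> E) (v # q)"
      unfolding simple_cycles_at_def by (cases c) auto
    have tw: "takeWhile (\<lambda>a. a \<noteq> v) (q @ v # p) = q" "dropWhile (\<lambda>a. a \<noteq> v) (q @ v # p) = v # p"
      using q(2) by (auto simp: takeWhile_append dropWhile_append)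
    let ?i = "\<lambda>p. (tl (dropWhile (\<lambda>a. a \<noteq> v) p), v # takeWhile (\<lambda>a. a \<noteq> v) p)"
    let ?j = "\<lambda>(p, c). rotate1 c @ p"
    show "?i (?j pc) = pc" using tw by (simp add: pc c)
    have "successively (\<lambda>a b. (a, b) \<in> E) (q @ v # p)" "(v, hd (q @ v # p)) \<in> E"
      using p q successively_rotate[of "\<lambda>a b. (a, b) \<in> E" q v p] by simp_all
    then show "?j pc \<in> {p. p \<in> ?T \<and> v \<in> set p}"
      using p q False by (auto simp: pc c simple_paths_def)
    have "W - set (q @ v # p) = W - set p - set (v # q)" by auto
    then show "?t (?j pc) = (case pc of (p, c) \<Rightarrow> fps_X ^ (length p + length c) * Q (W - set p - set c))"
      by (simp add: pc c add.commute)
  next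
    let ?i = "\<lambda>p. (tl (dropWhile (\<lambda>a. a \<noteq> v) p), v # takeWhile (\<lambda>a. a \<noteq> v) p)"
    let ?j = "\<lambda>(p, c). rotate1 c @ p"
    fix p assume p: "p \<in> {p. p \<in> ?T \<and> v \<in> set p}"
    then obtain q r where qr: "p = q @ v # r" "v \<notin> set q" using split_list_first[of v p] by auto
    have "distinct p" using p by (auto simp: simple_paths_def)
    have tw: "takeWhile (\<lambda>a. a \<noteq> v) p = q" "dropWhile (\<lambda>a. a \<noteq> v) p = v # r"
      using qr by (auto simp: takeWhile_append dropWhile_append)
    show "?j (?i p) = p" using tw by (simp add: qr)
    have pw: "(v, hd p) \<in> E" "last p = w" "set p \<subseteq> W" "successively (\<lambda>a b. (a, b) \<in> E) p"
      using p by (auto simp: simple_paths_def)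
    then have r: "r \<noteq> []" using qr False by auto
    then have "r \<in> ?T1"
      using pw \<open>distinct p\<close> successively_rotate[of "\<lambda>a b. (a, b) \<in> E" q v r]
      by (auto simp: qr simple_paths_def)
    moreover have "v # q \<in> simple_cycles_at E (W - set r) v"
    proof -
      have "successively (\<lambda>a b. (a, b) \<in> E) (v # q)" "(last (v # q), v) \<in> E"
        using pw successively_rotate[of "\<lambda>a b. (a, b) \<in> E" q v r] by (simp_all add: qr)
      then show ?thesis using pw(3) \<open>distinct p\<close> by (auto simp: qr simple_cycles_at_def)
    qed
    ultimately show "?i p \<in> (SIGMA p:?T1. simple_cycles_at E (W - set p) v)"
      unfolding tw by auto
  qed
  finally have "(\<Sum>p\<in>?T1. fps_X ^ length p * Q (W - {v} - set p)) =
      (\<Sum>p | p \<in> ?T \<and> v \<notin> set p. ?t p) + (\<Sum>p | p \<in> ?T \<and> v \<in> set p. ?t p)"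
    unfolding T1 by simp
  also have "\<dots> = (\<Sum>p\<in>?T. ?t p)"
    by (subst sum.union_disjoint[symmetric])
      (auto intro: rev_finite_subset[OF fin(1)] intro!: sum.cong)
  also have "\<dots> = (\<Sum>x\<in>E `` {v}. path_sum E Q W x w)"
    unfolding path_sum_def by (rule sum_simple_paths_UN[OF W(1) E, symmetric])
  finally have main: "(\<Sum>p\<in>?T1. fps_X ^ length p * Q (W - {v} - set p)) =
    (\<Sum>x\<in>E `` {v}. path_sum E Q W x w)" .
  have "simple_paths E W v w = (#) v ` ?T1"
    using simple_paths_Cons[OF False W(2)] by auto
  then have "path_sum E Q W v w = (\<Sum>p\<in>?T1. fps_X ^ length (v # p) * Q (W - set (v # p)))"
    unfolding path_sum_def by (simp add: sum.reindex)
  also have "\<dots> = fps_X * (\<Sum>p\<in>?T1. fps_X ^ length p * Q (W - {v} - set p))"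
    unfolding sum_distrib_left by (intro sum.cong refl) (simp add: mult.assoc flip: Diff_insert2)
  finally show ?thesis using main False by simp
qed

abbreviation cyclic_pairs :: "'a list \<Rightarrow> ('a \<times> 'a) list" where
  "cyclic_pairs p \<equiv> zip p (rotate1 p)"

definition closed_list :: "'a rel \<Rightarrow> 'a list \<Rightarrow> bool" where
  "closed_list E p \<longleftrightarrow> p \<noteq> [] \<and> set (cyclic_pairs p) \<subseteq> E"

text \<open>A walk is listed without its end point \<open>y\<close>, so that closed walks are closed lists.\<close>

definition walks :: "'a rel \<Rightarrow> nat \<Rightarrow> 'a \<Rightarrow> 'a \<Rightarrow> 'a list set" where
  "walks E k x y = {q. length q = k \<and> hd (q @ [y]) = x \<and> successively (\<lambda>a b. (a, b) \<in> E) (q @ [y])}"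

definition walk_series :: "'a rel \<Rightarrow> 'a \<Rightarrow> 'a \<Rightarrow> 'r::comm_ring_1 fps" where
  "walk_series E x y = Abs_fps (\<lambda>k. of_nat (card (walks E k x y)))"

lemma walks_0: "walks E 0 x y = (if x = y then {[]} else {})"
  by (auto simp: walks_def)

lemma walks_Suc: "walks E (Suc k) x y = (#) x ` (\<Union>z\<in>E `` {x}. walks E k z y)"
proof (intro equalityI subsetI)
  fix q assume "q \<in> walks E (Suc k) x y"
  then obtain r where "q = x # r" "length r = k" "(x, hd (r @ [y])) \<in> E"
    "successively (\<lambda>a b. (a, b) \<in> E) (r @ [y])"
    unfolding walks_def by (auto simp: length_Suc_conv successively_Cons)
  then show "q \<in> (#) x ` (\<Union>z\<in>E `` {x}. walks E k z y)" by (auto simp: walks_def)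
qed (auto simp: walks_def successively_Cons)

lemma finite_walks: "finite E \<Longrightarrow> finite (walks E k x y)"
proof (induction k arbitrary: x)
  case (Suc k)
  then show ?case unfolding walks_Suc by (intro finite_imageI finite_UN_I finite_Image) auto
qed (simp add: walks_0)

lemma card_walks_Suc:
  assumes "finite E"
  shows "card (walks E (Suc k) x y) = (\<Sum>z\<in>E `` {x}. card (walks E k z y))"
proof -
  have "card (walks E (Suc k) x y) = card (\<Union>z\<in>E `` {x}. walks E k z y)"
    unfolding walks_Suc by (rule card_image) simp
  also have "\<dots> = (\<Sum>z\<in>E `` {x}. card (walks E k z y))"
  proof (rule card_UN_disjoint)
    show "\<forall>z\<in>E `` {x}. \<forall>z'\<in>E `` {x}. z \<noteq> z' \<longrightarrow> walks E k z y \<inter> walks E k z' y = {}"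
      by (auto simp: walks_def)
  qed (use assms in \<open>auto simp: finite_walks intro: finite_Image\<close>)
  finally show ?thesis .
qed

lemma walk_series_step:
  assumes "finite E"
  shows "walk_series E x y =
    (if x = y then 1 else 0) + fps_X * (\<Sum>z\<in>E `` {x}. walk_series E z y :: ('r::comm_ring_1) fps)"
proof (rule fps_ext)
  fix k
  show "fps_nth (walk_series E x y) k = fps_nth
    ((if x = y then 1 else 0) + fps_X * (\<Sum>z\<in>E `` {x}. walk_series E z y :: 'r fps)) k"
    by (cases k) (simp_all add: walk_series_def walks_0 card_walks_Suc[OF assms] fps_sum_nth)
qed

lemma mult_walk_series_eq_path_sum:
  fixes Q :: "'a set \<Rightarrow> 'r::comm_ring_1 fps"
  assumes V: "finite V" "E \<subseteq> V \<times> V"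
    and Q: "\<And>U v. U \<subseteq> V \<Longrightarrow> v \<in> U \<Longrightarrow>
      Q U = Q (U - {v}) - (\<Sum>p\<in>simple_cycles_at E U v. fps_X ^ length p * Q (U - set p))"
    and x: "x \<in> V"
  shows "fps_X * Q V * walk_series E x y = path_sum E Q V x y"
proof -
  have E: "finite E" using V by (auto intro: finite_subset)
  define D where "D x = fps_X * Q V * walk_series E x y - path_sum E Q V x y" for x
  have step: "D x = fps_X * (\<Sum>z\<in>E `` {x}. D z)" if "x \<in> V" for x
  proof -
    have "D x = fps_X * Q V * ((if x = y then 1 else 0) + fps_X * (\<Sum>z\<in>E `` {x}. walk_series E z y)) -
      fps_X * ((if x = y then Q V else 0) + (\<Sum>z\<in>E `` {x}. path_sum E Q V z y))"
      unfolding D_def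
      by (subst walk_series_step[OF E], subst path_sum_step[OF E V(1) that Q]) auto
    then show ?thesis
      by (cases "x = y") (simp_all add: D_def sum_subtractf sum_distrib_left algebra_simps)
  qed
  have "fps_nth (D x) k = 0" if "x \<in> V" for k
    using that
  proof (induction k arbitrary: x)
    case 0
    show ?case unfolding step[OF 0] by simp
  next
    case (Suc k)
    have "fps_nth (D z) k = 0" if "z \<in> E `` {x}" for z using Suc.IH[of z] V(2) that by auto
    then show ?case
      unfolding step[OF Suc.prems] fps_X_mult_nth by (simp only: fps_sum_nth sum.neutral_const cong: sum.cong) simp
  qed
  then have "D x = 0" using x by (simp add: fps_eq_iff)
  then show ?thesis by (simp add: D_def)
qed

lemma mult_walk_series_diag:
  fixes Q :: "'a set \<Rightarrow> 'r::idom fps"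
  assumes V: "finite V" "E \<subseteq> V \<times> V"
    and Q: "\<And>U v. U \<subseteq> V \<Longrightarrow> v \<in> U \<Longrightarrow>
      Q U = Q (U - {v}) - (\<Sum>p\<in>simple_cycles_at E U v. fps_X ^ length p * Q (U - set p))"
    and v: "v \<in> V"
  shows "Q V * walk_series E v v = Q (V - {v})"
proof -
  have "fps_X * (Q V * walk_series E v v) = fps_X * Q (V - {v})"
    using mult_walk_series_eq_path_sum[OF V Q v, of v]
    by (simp add: path_sum_def simple_paths_same[OF v] mult.assoc)
  then show ?thesis by simp
qed

lemma set_zip_Cons_snoc: "set (zip (x # q) (q @ [y])) \<subseteq> E \<longleftrightarrow> successively (\<lambda>a b. (a, b) \<in> E) (x # q @ [y])"
  by (induction q arbitrary: x) auto

lemma closed_lists_of_length: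
  assumes "E \<subseteq> V \<times> V" "k > 0"
  shows "{p. length p = k \<and> closed_list E p} = (\<Union>v\<in>V. walks E k v v)"
proof (intro equalityI subsetI)
  fix p assume p: "p \<in> {p. length p = k \<and> closed_list E p}"
  then obtain x q where "p = x # q" by (cases p) (auto simp: closed_list_def)
  then have "p \<in> walks E k x x" "(x, hd (q @ [x])) \<in> E"
    using p set_zip_Cons_snoc[of x q x E]
    by (auto simp: closed_list_def walks_def successively_Cons)
  then show "p \<in> (\<Union>v\<in>V. walks E k v v)" using assms(1) by auto
next
  fix p assume "p \<in> (\<Union>v\<in>V. walks E k v v)"
  then obtain x where x: "p \<in> walks E k x x" by blast
  then obtain q where "p = x # q" using assms(2) by (cases p) (auto simp: walks_def)
  then show "p \<in> {p. length p = k \<and> closed_list E p}"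
    using x set_zip_Cons_snoc[of x q x E] by (auto simp: closed_list_def walks_def)
qed

lemma finite_closed_lists:
  assumes "finite E" shows "finite {p. length p = k \<and> closed_list E p}"
proof (cases k)
  case (Suc m)
  have "E \<subseteq> (fst ` E \<union> snd ` E) \<times> (fst ` E \<union> snd ` E)" by force
  then show ?thesis
    using assms Suc by (subst closed_lists_of_length) (auto simp: finite_walks)
qed (simp add: closed_list_def)

definition closed_series :: "'a rel \<Rightarrow> 'r::comm_ring_1 fps" where
  "closed_series E = Abs_fps (\<lambda>k. of_nat (card {p. length p = k \<and> closed_list E p}))"

lemma mult_closed_series:
  fixes Q :: "'a set \<Rightarrow> 'r::idom fps"
  assumes V: "finite V" "E \<subseteq> V \<times> V"
    and Q: "\<And>U v. U \<subseteq> V \<Longrightarrow> v \<in> U \<Longrightarrow>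
      Q U = Q (U - {v}) - (\<Sum>p\<in>simple_cycles_at E U v. fps_X ^ length p * Q (U - set p))"
  shows "Q V * closed_series E = (\<Sum>v\<in>V. Q (V - {v}) - Q V)"
proof -
  have E: "finite E" using V by (auto intro: finite_subset)
  have "closed_series E = (\<Sum>v\<in>V. walk_series E v v - 1 :: 'r fps)"
  proof (rule fps_ext)
    fix k
    show "fps_nth (closed_series E) k = fps_nth (\<Sum>v\<in>V. walk_series E v v - 1 :: 'r fps) k"
    proof (cases k)
      case (Suc m)
      have "card (\<Union>v\<in>V. walks E k v v) = (\<Sum>v\<in>V. card (walks E k v v))"
      proof (rule card_UN_disjoint)
        show "\<forall>x\<in>V. \<forall>y\<in>V. x \<noteq> y \<longrightarrow> walks E k x x \<inter> walks E k y y = {}"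
          using Suc by (auto simp: walks_def length_Suc_conv)
      qed (use V E in \<open>auto simp: finite_walks\<close>)
      then show ?thesis
        using Suc closed_lists_of_length[OF V(2), of k]
        by (simp add: closed_series_def walk_series_def fps_sum_nth)
    next
      case 0
      have "{p. p = [] \<and> closed_list E p} = {}" by (auto simp: closed_list_def)
      then show ?thesis using 0
        by (simp add: closed_series_def walk_series_def fps_sum_nth walks_0 del: Collect_empty_eq)
    qed
  qed
  then have "Q V * closed_series E = (\<Sum>v\<in>V. Q V * walk_series E v v - Q V)"
    by (simp add: sum_distrib_left right_diff_distrib)
  also have "\<dots> = (\<Sum>v\<in>V. Q (V - {v}) - Q V)"
    using mult_walk_series_diag[OF V Q] by (intro sum.cong) auto
  finally show ?thesis .
qed


section \<open>Primitive words and rotation classes\<close>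

abbreviation list_power :: "'a list \<Rightarrow> nat \<Rightarrow> 'a list" where
  "list_power p r \<equiv> concat (replicate r p)"

definition primitive :: "'a list \<Rightarrow> bool" where
  "primitive p \<longleftrightarrow> p \<noteq> [] \<and> \<not> (\<exists>q r. r \<ge> 2 \<and> p = list_power q r)"

lemma list_power_add: "list_power p (m + n) = list_power p m @ list_power p n"
  by (simp add: replicate_add)

lemma list_power_mult: "list_power (list_power p m) n = list_power p (m * n)"
  by (induction n) (simp_all add: list_power_add)

lemma length_list_power: "length (list_power p r) = r * length p"
  by (simp add: length_concat sum_list_replicate)

lemma list_power_snoc: "p @ list_power p r = list_power p r @ p"
  by (induction r) simp_all

lemma list_power_rotate1: "x # list_power (q @ [x]) r = list_power (x # q) r @ [x]"
  by (induction r) simp_all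

lemma rotate1_list_power: "rotate1 (list_power p r) = list_power (rotate1 p) r"
proof (cases p; cases r)
  fix x q m assume "p = x # q" "r = Suc m"
  then show ?thesis using list_power_rotate1[where x = x and q = q and r = m] by simp
qed simp_all

lemma zip_list_power:
  "length p = length q \<Longrightarrow> zip (list_power p r) (list_power q r) = list_power (zip p q) r"
  by (induction r) (simp_all add: length_list_power)

lemma closed_list_power: "r > 0 \<Longrightarrow> closed_list E (list_power p r) \<longleftrightarrow> closed_list E p"
  by (cases "p = []") (auto simp: closed_list_def rotate1_list_power zip_list_power)

lemma rotate_cyclic_pairs: "rotate k (cyclic_pairs p) = cyclic_pairs (rotate k p)"
proof -
  have "rotate k (zip p q) = zip (rotate k p) (rotate k q)" if "length p = length q" for q :: "'a list"
    using that by (simp add: rotate_drop_take zip_append drop_zip take_zip)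
  then show ?thesis by (simp add: rotate1_rotate_swap)
qed

lemma closed_list_rotate: "closed_list E (rotate k p) \<longleftrightarrow> closed_list E p"
  by (simp add: closed_list_def flip: rotate_cyclic_pairs)

lemma primitive_commute_eq:
  assumes "primitive p" "primitive q" "p @ q = q @ p"
  shows "p = q"
proof -
  obtain m n z where "p = list_power z m" "q = list_power z n"
    using comm_append_are_replicate[OF assms(3)] by metis
  note pq = this
  have "k = 1" if "primitive (list_power z k)" for k
  proof -
    have "k \<noteq> 0" using that by (auto simp: primitive_def)
    moreover have "\<not> k \<ge> 2" using that by (auto simp: primitive_def)
    ultimately show ?thesis by simp
  qed
  then have "m = 1" "n = 1" using assms(1,2) unfolding pq by blast+
  then show ?thesis using pq by simp
qed

lemma primitive_root_unique:
  assumes "primitive p" "primitive q" "list_power p m = list_power q n" "m > 0" "n > 0"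
  shows "p = q"
proof -
  let ?w = "list_power p m"
  obtain p' q' where p': "?w = p @ p'" and q': "?w = q @ q'"
    using assms(3-5) by (cases m; cases n) auto
  have "p @ q @ q' = p @ ?w" using q' by simp
  also have "\<dots> = ?w @ p" by (rule list_power_snoc)
  finally have "p @ q @ (q' @ p') = ?w @ ?w" using p' by simp
  moreover have "q @ p @ p' = ?w @ q"
    using list_power_snoc[where p = q and r = n] p' assms(3) by simp
  then have "q @ p @ (p' @ q') = ?w @ ?w" using q' by simp
  ultimately have "(p @ q) @ (q' @ p') = (q @ p) @ (p' @ q')" by simp
  then have "p @ q = q @ p" by (subst (asm) append_eq_append_conv) auto
  with assms(1,2) show ?thesis by (rule primitive_commute_eq)
qed

lemma primitive_root_exists:
  "w \<noteq> [] \<Longrightarrow> \<exists>p r. primitive p \<and> r > 0 \<and> w = list_power p r"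
proof (induction "length w" arbitrary: w rule: less_induct)
  case less
  show ?case
  proof (cases "primitive w")
    case True
    then show ?thesis by (intro exI[of _ w] exI[of _ 1]) simp
  next
    case False
    then obtain q r where qr: "r \<ge> 2" "w = list_power q r" using less.prems by (auto simp: primitive_def)
    then have "q \<noteq> []" using less.prems by auto
    then have "length q < length w" using qr by (simp add: length_list_power)
    then obtain p k where "primitive p" "k > 0" "q = list_power p k"
      using less.hyps[of q] \<open>q \<noteq> []\<close> by blast
    then show ?thesis using qr by (intro exI[of _ p] exI[of _ "k * r"]) (simp add: list_power_mult)
  qed
qed

lemma primitive_rotate_eq:
  assumes "primitive p" "rotate k p = p" "k < length p"
  shows "k = 0"
proof (rule ccontr)
  assume "k \<noteq> 0"
  let ?u = "take k p" and ?v = "drop k p"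
  have "p = ?v @ ?u" using assms(2,3) by (simp add: rotate_drop_take)
  then have comm: "?u @ ?v = ?v @ ?u" by (metis append_take_drop_id)
  moreover have "?u \<noteq> []" "?v \<noteq> []" using \<open>k \<noteq> 0\<close> assms(3) by auto
  ultimately obtain n z where "n > 1" "list_power z n = ?u @ ?v"
    using comm_append_is_replicate by blast
  then have "n \<ge> 2" "p = list_power z n" by simp_all
  with assms(1) show False unfolding primitive_def by blast
qed

lemma rotate_inverse: "\<exists>j. rotate j (rotate k p) = p"
proof (cases "p = []")
  case False
  then have "rotate (length p - k mod length p) (rotate (k mod length p) p) = p"
    by (subst rotate_rotate) (simp add: mod_le_divisor less_imp_le)
  then show ?thesis by (auto simp flip: rotate_conv_mod)
qed simp

lemma primitive_rotate: "primitive p \<Longrightarrow> primitive (rotate k p)"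
proof -
  have rot: "rotate k (list_power q r) = list_power (rotate k q) r" for k q r
    by (induction k) (simp_all add: rotate1_list_power)
  obtain j where inv: "rotate j (rotate k p) = p" using rotate_inverse by blast
  assume p: "primitive p"
  have False if r: "r \<ge> 2" "rotate k p = list_power q r" for q r
  proof -
    have "p = list_power (rotate j q) r" by (metis inv rot r(2))
    then show False using p r(1) unfolding primitive_def by blast
  qed
  then show ?thesis using p by (auto simp: primitive_def)
qed

lemma equiv_rotation_rel: "equiv UNIV rotation_rel"
proof (rule equivI)
  have rel: "(p, q) \<in> rotation_rel \<longleftrightarrow> (\<exists>k. q = rotate k p)" for p q :: "'a list"
    by (simp add: rotation_rel_def)
  have "(p, p) \<in> rotation_rel" for p :: "'a list" unfolding rel by (rule exI[of _ 0]) simp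
  then show "refl (rotation_rel :: 'a list rel)" by (simp add: refl_on_def)
  show "sym (rotation_rel :: 'a list rel)" unfolding sym_def rel by (metis rotate_inverse)
  show "trans (rotation_rel :: 'a list rel)" unfolding trans_def rel by (metis rotate_rotate)
qed simp

lemma rotation_rel_Image: "rotation_rel `` {p} = range (\<lambda>k. rotate k p)"
  by (auto simp: rotation_rel_def)

lemma class_length_Image: "class_length (rotation_rel `` {p}) = length p"
  using class_length_rotation[of "rotation_rel `` {p}" UNIV p] equiv_class_self[OF equiv_rotation_rel]
  by (auto simp: quotientI)

lemma card_rotation_class:
  assumes "primitive p"
  shows "card (rotation_rel `` {p}) = length p"
proof -
  have p: "p \<noteq> []" using assms by (simp add: primitive_def)
  have "rotate k p = rotate (k mod length p) p" "k mod length p < length p" for k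
    using p by (simp_all flip: rotate_conv_mod)
  then have "rotation_rel `` {p} = (\<lambda>k. rotate k p) ` {..<length p}"
    unfolding rotation_rel_Image by blast
  moreover have "inj_on (\<lambda>k. rotate k p) {..<length p}"
  proof (rule linorder_inj_onI)
    fix i j assume ij: "i < j" "i \<in> {..<length p}" "j \<in> {..<length p}"
    show "rotate i p \<noteq> rotate j p"
    proof
      assume eq: "rotate i p = rotate j p"
      have "rotate (j - i) (rotate i p) = rotate j p" using ij by (simp add: rotate_rotate)
      with eq have "rotate (j - i) (rotate i p) = rotate i p" by simp
      moreover have "primitive (rotate i p)" using assms by (rule primitive_rotate)
      ultimately have "j - i = 0" using primitive_rotate_eq ij by (metis lessThan_iff length_rotate less_imp_diff_less)
      then show False using ij by simp
    qed
  qed auto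
  ultimately show ?thesis by (simp add: card_image)
qed

lemma sum_class_length:
  assumes "finite E" "m > 0"
  defines "R \<equiv> {p. closed_list E p \<and> primitive p} // rotation_rel"
  shows "(\<Sum>c | c \<in> R \<and> class_length c dvd m. class_length c) =
    card {p. length p = m \<and> closed_list E p}"
proof -
  let ?A = "{p. closed_list E p \<and> primitive p}"
  let ?R = "{c. c \<in> R \<and> class_length c dvd m}"
  have R: "\<exists>p. p \<in> ?A \<and> c = rotation_rel `` {p}" if "c \<in> R" for c
    using that unfolding R_def by (rule quotientE) auto
  have RA: "p \<in> ?A \<and> length p = class_length c \<and> c = rotation_rel `` {p}" if "c \<in> R" "p \<in> c" for c p
  proof -
    obtain q where q: "q \<in> ?A" "c = rotation_rel `` {q}" using R[OF \<open>c \<in> R\<close>] by blast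
    then obtain k where "p = rotate k q" using \<open>p \<in> c\<close> by (auto simp: rotation_rel_Image)
    moreover have "rotation_rel `` {q} = rotation_rel `` {p}"
      using q(2) \<open>p \<in> c\<close> by (intro equiv_class_eq[OF equiv_rotation_rel]) simp
    ultimately show ?thesis
      using q by (simp add: closed_list_rotate primitive_rotate class_length_Image)
  qed
  have card: "card c = class_length c" if "c \<in> R" for c
    using R[OF that] by (auto simp: card_rotation_class class_length_Image)
  have "finite ?R"
  proof (rule finite_subset)
    show "?R \<subseteq> Pow (\<Union>k\<le>m. {p. length p = k \<and> closed_list E p})"
    proof
      fix c assume "c \<in> ?R"
      then have "length p \<le> m \<and> closed_list E p" if "p \<in> c" for p
        using RA[of c p] that dvd_imp_le[OF _ assms(2)] by auto
      then show "c \<in> Pow (\<Union>k\<le>m. {p. length p = k \<and> closed_list E p})" by auto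
    qed
    show "finite (Pow (\<Union>k\<le>m. {p. length p = k \<and> closed_list E p}))"
      using finite_closed_lists[OF assms(1)] by auto
  qed
  moreover have "finite c" if "c \<in> R" for c
    using R[OF that] card[OF that]
    by (auto simp: class_length_Image primitive_def intro: card_ge_0_finite)
  ultimately have "(\<Sum>c\<in>?R. class_length c) = card (SIGMA c:?R. c)"
    using card by (subst card_SigmaI) auto
  also have "\<dots> = card {p. length p = m \<and> closed_list E p}"
  proof (rule bij_betw_same_card)
    let ?f = "\<lambda>(c, p). list_power p (m div length p)"
    show "bij_betw ?f (SIGMA c:?R. c) {p. length p = m \<and> closed_list E p}"
      unfolding bij_betw_def
    proof
      show "inj_on ?f (SIGMA c:?R. c)"
      proof (rule inj_onI, clarify)
        fix c p d q
        assume c: "c \<in> R" "p \<in> c" "class_length c dvd m" and d: "d \<in> R" "q \<in> d" "class_length d dvd m"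
          and eq: "list_power p (m div length p) = list_power q (m div length q)"
        note p = RA[OF c(1,2)] and q = RA[OF d(1,2)]
        have "m div length p > 0" "m div length q > 0"
          using c(3) d(3) p q assms(2) by (auto simp: div_greater_zero_iff dvd_imp_le primitive_def)
        then have "p = q" using p q by (intro primitive_root_unique[OF _ _ eq]) auto
        with p q show "c = d \<and> p = q" by simp
      qed
      show "?f ` (SIGMA c:?R. c) = {p. length p = m \<and> closed_list E p}"
      proof (intro equalityI subsetI)
        fix w assume "w \<in> ?f ` (SIGMA c:?R. c)"
        then obtain c p where c: "c \<in> R" "p \<in> c" "class_length c dvd m"
          and w: "w = list_power p (m div length p)" by auto
        note p = RA[OF c(1,2)]
        have "m div length p > 0"
          using c(3) p assms(2) by (auto simp: div_greater_zero_iff dvd_imp_le primitive_def)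
        then show "w \<in> {p. length p = m \<and> closed_list E p}"
          using p c(3) by (simp add: w length_list_power closed_list_power)
      next
        fix w assume w: "w \<in> {p. length p = m \<and> closed_list E p}"
        then obtain p r where p: "primitive p" "r > 0" "w = list_power p r"
          using primitive_root_exists[of w] by (auto simp: closed_list_def)
        then have pA: "p \<in> ?A" using w by (simp add: closed_list_power)
        have m: "m = r * length p" using w p by (simp add: length_list_power)
        have "rotation_rel `` {p} \<in> ?R"
          using pA m by (simp add: R_def quotientI class_length_Image)
        moreover have "p \<in> rotation_rel `` {p}" by (rule equiv_class_self[OF equiv_rotation_rel]) simp
        moreover have "m div length p = r" using m p(1) by (simp add: primitive_def)
        ultimately show "w \<in> ?f ` (SIGMA c:?R. c)"
          using p(3) by (intro image_eqI[of _ _ "(rotation_rel `` {p}, p)"]) auto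
      qed
    qed
  qed
  finally show ?thesis .
qed


section \<open>The Euler product\<close>

lemma fps_X_mult_deriv_unique:
  fixes f g :: "('r::field_char_0) fps"
  assumes "fps_nth f 0 = fps_nth g 0"
    and "fps_X * fps_deriv f = f * S" "fps_X * fps_deriv g = g * T"
    and "fps_nth S 0 = 0" "\<And>k. k \<le> n \<Longrightarrow> fps_nth S k = fps_nth T k"
  shows "k \<le> n \<Longrightarrow> fps_nth f k = fps_nth g k"
proof (induction k rule: less_induct)
  case (less k)
  show ?case
  proof (cases "k = 0")
    case False
    have T0: "fps_nth T 0 = 0" using assms(4) assms(5)[of 0] by simp
    have "of_nat k * fps_nth f k = fps_nth (f * S) k" "of_nat k * fps_nth g k = fps_nth (g * T) k"
      using False by (simp_all flip: assms(2,3))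
    moreover have "fps_nth (f * S) k = fps_nth (g * T) k"
      unfolding fps_mult_nth
    proof (rule sum.cong[OF refl])
      fix i assume "i \<in> {0..k}"
      then show "fps_nth f i * fps_nth S (k - i) = fps_nth g i * fps_nth T (k - i)"
        using less assms(4,5) T0 by (cases "i = k") auto
    qed
    ultimately have "of_nat k * fps_nth f k = of_nat k * fps_nth g k" by (simp only:)
    then show ?thesis using False by simp
  qed (use assms(1) in simp)
qed

lemma geometric_fps_nth:
  assumes "l > 0"
  shows "fps_nth (fps_X ^ l * inverse (1 - fps_X ^ l) :: ('r::field) fps) m =
    (if m > 0 \<and> l dvd m then 1 else 0)"
proof -
  let ?G = "Abs_fps (\<lambda>m. if m > 0 \<and> l dvd m then 1 else 0) :: 'r fps"
  have "?G * (1 - fps_X ^ l) = fps_X ^ l"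
  proof (rule fps_ext)
    fix m
    have "l dvd m - l \<longleftrightarrow> l dvd m" if "m \<ge> l" using that by (simp add: dvd_minus_self)
    then show "fps_nth (?G * (1 - fps_X ^ l)) m = fps_nth (fps_X ^ l) m"
      using assms by (auto simp: right_diff_distrib fps_X_power_mult_right_nth dest: dvd_imp_le)
  qed
  then have "fps_X ^ l * inverse (1 - fps_X ^ l) = ?G * ((1 - fps_X ^ l) * inverse (1 - fps_X ^ l))"
    by (simp add: mult.assoc)
  also have "(1 - fps_X ^ l) * inverse (1 - fps_X ^ l) = (1 :: 'r fps)"
    using assms by (intro inverse_mult_eq_1') simp
  finally show ?thesis by simp
qed

lemma fps_X_mult_deriv_prod_inverse:
  fixes l :: "'c \<Rightarrow> nat"
  assumes "finite F" "\<And>c. c \<in> F \<Longrightarrow> l c > 0"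
  defines "Z \<equiv> \<Prod>c\<in>F. inverse (1 - fps_X ^ l c) :: ('r::field_char_0) fps"
  shows "fps_X * fps_deriv Z = Z * (\<Sum>c\<in>F. of_nat (l c) * (fps_X ^ l c * inverse (1 - fps_X ^ l c)))"
proof -
  have one: "fps_X * fps_deriv (inverse (1 - fps_X ^ k)) =
    inverse (1 - fps_X ^ k) * (of_nat k * (fps_X ^ k * inverse (1 - fps_X ^ k :: 'r fps)))"
    if "k > 0" for k :: nat
  proof -
    let ?a = "1 - fps_X ^ k :: 'r fps"
    have "fps_deriv (inverse ?a) = - fps_deriv ?a * (inverse ?a)\<^sup>2"
      using that by (intro fps_inverse_deriv) simp
    then have "fps_X * fps_deriv (inverse ?a) = (fps_X * fps_deriv (fps_X ^ k)) * (inverse ?a)\<^sup>2"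
      by (simp add: mult.assoc)
    also have "fps_X * fps_deriv (fps_X ^ k) = of_nat k * (fps_X ^ k :: 'r fps)"
      by (induction k) (simp_all add: algebra_simps)
    finally show ?thesis by (simp add: power2_eq_square mult_ac)
  qed
  show ?thesis unfolding Z_def using assms(1,2)
  proof (induction F rule: finite_induct)
    case (insert c F)
    let ?i = "inverse (1 - fps_X ^ l c) :: 'r fps" and ?P = "\<Prod>c\<in>F. inverse (1 - fps_X ^ l c) :: 'r fps"
    let ?s = "of_nat (l c) * (fps_X ^ l c * ?i)"
      and ?S = "\<Sum>c\<in>F. of_nat (l c) * (fps_X ^ l c * inverse (1 - fps_X ^ l c)) :: 'r fps"
    have IH: "fps_X * fps_deriv ?P = ?P * ?S" using insert by simp
    have "fps_X * fps_deriv (?i * ?P) = ?i * (fps_X * fps_deriv ?P) + (fps_X * fps_deriv ?i) * ?P"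
      by (simp only: fps_deriv_mult distrib_left mult_ac)
    also have "\<dots> = ?i * (?P * ?S) + (?i * ?s) * ?P"
      using one[of "l c"] insert.prems IH by simp
    also have "\<dots> = (?i * ?P) * (?s + ?S)" by (simp only: distrib_left mult_ac add_ac)
    finally show ?case using insert.hyps by simp
  qed simp
qed

lemma prod_inverse_tendsto:
  fixes P :: "rat fps"
  assumes E: "finite E"
    and P: "fps_nth P 0 = 1" "fps_X * fps_deriv P = - (P * closed_series E)"
  defines "R \<equiv> {p. closed_list E p \<and> primitive p} // rotation_rel"
  shows "((\<lambda>F. \<Prod>c\<in>F. inverse (1 - fps_X ^ class_length c)) \<longlongrightarrow> inverse P)
    (finite_subsets_at_top R)"
proof (rule tendsto_fpsI)
  fix n
  let ?f = "\<lambda>c. inverse (1 - fps_X ^ class_length c) :: rat fps"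
  have R: "\<exists>p. closed_list E p \<and> primitive p \<and> c = rotation_rel `` {p}" if "c \<in> R" for c
    using that unfolding R_def by (rule quotientE) auto
  then have pos: "class_length c > 0" if "c \<in> R" for c
    using that by (fastforce simp: class_length_Image primitive_def)
  have fin: "finite {c \<in> R. class_length c \<le> n}"
  proof (rule finite_subset)
    show "{c \<in> R. class_length c \<le> n} \<subseteq>
      (\<lambda>p. rotation_rel `` {p}) ` (\<Union>k\<le>n. {p. length p = k \<and> closed_list E p})"
    proof
      fix c assume c: "c \<in> {c \<in> R. class_length c \<le> n}"
      then obtain p where "closed_list E p" "c = rotation_rel `` {p}" using R by blast
      with c show "c \<in> (\<lambda>p. rotation_rel `` {p}) ` (\<Union>k\<le>n. {p. length p = k \<and> closed_list E p})"
        by (auto simp: class_length_Image)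
    qed
  qed (use finite_closed_lists[OF E] in auto)
  have inv: "P * inverse P = 1" using P(1) by (intro inverse_mult_eq_1') simp
  have "fps_deriv (inverse P) = - fps_deriv P * (inverse P)\<^sup>2"
    using P(1) by (intro fps_inverse_deriv) simp
  then have "fps_X * fps_deriv (inverse P) = - (fps_X * fps_deriv P) * (inverse P)\<^sup>2"
    by (simp add: mult.assoc)
  also have "\<dots> = (P * inverse P) * (inverse P * closed_series E)"
    by (simp only: P(2) minus_minus power2_eq_square mult_ac)
  finally have deriv: "fps_X * fps_deriv (inverse P) = inverse P * closed_series E"
    by (simp add: inv)
  show "\<forall>\<^sub>F F in finite_subsets_at_top R. fps_nth (prod ?f F) n = fps_nth (inverse P) n"
    unfolding eventually_finite_subsets_at_top
  proof (intro exI[of _ "{c \<in> R. class_length c \<le> n}"] conjI allI impI)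
    fix F assume F: "finite F \<and> {c \<in> R. class_length c \<le> n} \<subseteq> F \<and> F \<subseteq> R"
    let ?S = "\<Sum>c\<in>F. of_nat (class_length c) * (fps_X ^ class_length c * ?f c)"
    have S: "fps_nth ?S m = (if m = 0 then 0 else of_nat (\<Sum>c | c \<in> F \<and> class_length c dvd m. class_length c))" for m
    proof -
      have "fps_nth ?S m = (\<Sum>c\<in>F. of_nat (class_length c) * fps_nth (fps_X ^ class_length c * ?f c) m)"
        by (simp add: fps_sum_nth flip: fps_of_nat)
      also have "\<dots> = (\<Sum>c\<in>F. if m > 0 \<and> class_length c dvd m then of_nat (class_length c) else 0)"
        using F pos by (intro sum.cong refl) (subst geometric_fps_nth, auto)
      also have "\<dots> = (if m = 0 then 0 else of_nat (\<Sum>c | c \<in> F \<and> class_length c dvd m. class_length c))"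
        using F by (auto simp: sum.inter_filter intro: sum.cong)
      finally show ?thesis .
    qed
    show "fps_nth (prod ?f F) n = fps_nth (inverse P) n"
    proof (rule fps_X_mult_deriv_unique[OF _ _ deriv, of "prod ?f F" ?S n])
      have "fps_nth (prod ?f F * 1) 0 = fps_nth 1 0"
        using F pos by (intro prod_nth_low[of F 0] inverse_nth_low) auto
      then show "fps_nth (prod ?f F) 0 = fps_nth (inverse P) 0" using P(1) by simp
      show "fps_X * fps_deriv (prod ?f F) = prod ?f F * ?S"
        using F pos by (intro fps_X_mult_deriv_prod_inverse) auto
      show "fps_nth ?S 0 = 0" by (simp only: S if_True refl)
      fix m assume m: "m \<le> n"
      show "fps_nth ?S m = fps_nth (closed_series E) m"
      proof (cases "m = 0")
        case True
        have "{p. p = [] \<and> closed_list E p} = {}" by (auto simp: closed_list_def)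
        then show ?thesis
          using True by (simp add: S closed_series_def del: Collect_empty_eq)
      next
        case False
        have "{c. c \<in> F \<and> class_length c dvd m} = {c. c \<in> R \<and> class_length c dvd m}"
          using F False m dvd_imp_le[of _ m] by fastforce
        then show ?thesis
          using False sum_class_length[OF E, of m] by (simp add: S closed_series_def R_def)
      qed
    qed simp
  qed (use fin in auto)
qed


section \<open>Classes of simple cycles\<close>

lemma cas_iff_map: "pre_digraph.cas (with_proj H) u C v \<longleftrightarrow> u # map snd C = map fst C @ [v]"
proof (induction C arbitrary: u)
  case Nil
  show ?case by (simp add: pre_digraph.cas.simps)
next
  case (Cons e C)
  then show ?case by (auto simp: pre_digraph.cas.simps)
qed

lemma is_cycle_iff:
  assumes "pair_wf_digraph H"
  shows "is_cycle H C \<longleftrightarrow> C \<noteq> [] \<and> set C \<subseteq> parcs H \<and> map snd C = rotate1 (map fst C)"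
proof (cases C)
  case (Cons e D)
  have "e \<in> parcs H \<Longrightarrow> fst e \<in> pverts H"
    using pair_wf_digraph.arc_fst_in_verts[OF assms] by blast
  then show ?thesis
    using Cons by (auto simp: is_cycle_def pre_digraph.awalk_def cas_iff_map)
qed (simp add: is_cycle_def)

lemma is_cycle_iff_closed_list:
  assumes "pair_wf_digraph H"
  shows "is_cycle H C \<longleftrightarrow> closed_list (parcs H) (map fst C) \<and> C = cyclic_pairs (map fst C)"
proof -
  have "map snd C = rotate1 (map fst C) \<longleftrightarrow> C = cyclic_pairs (map fst C)"
    by (metis length_map length_rotate1 map_snd_zip zip_map_fst_snd)
  then show ?thesis
    unfolding is_cycle_iff[OF assms] closed_list_def by auto
qed

lemma map_fst_cyclic_pairs: "map fst (cyclic_pairs p) = p"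
  by simp

lemma closed_list_subset:
  assumes "pair_wf_digraph H" "closed_list (parcs H) p"
  shows "set p \<subseteq> pverts H"
proof -
  have "set p = fst ` set (cyclic_pairs p)" by (metis map_fst_cyclic_pairs set_map)
  also have "\<dots> \<subseteq> fst ` parcs H" using assms(2) by (simp add: closed_list_def image_mono)
  also have "\<dots> \<subseteq> pverts H" using pair_wf_digraph.arc_fst_in_verts[OF assms(1)] by blast
  finally show ?thesis .
qed

lemma simple_cycles_eq:
  assumes "pair_wf_digraph H"
  shows "{C. simple_cycle H C} = cyclic_pairs ` {p. closed_list (parcs H) p \<and> distinct p}"
proof (intro equalityI subsetI)
  fix C assume "C \<in> {C. simple_cycle H C}"
  then show "C \<in> cyclic_pairs ` {p. closed_list (parcs H) p \<and> distinct p}"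
    by (intro image_eqI[of _ _ "map fst C"])
      (simp_all add: simple_cycle_def is_cycle_iff_closed_list[OF assms])
next
  fix C assume "C \<in> cyclic_pairs ` {p. closed_list (parcs H) p \<and> distinct p}"
  then show "C \<in> {C. simple_cycle H C}"
    by (auto simp: simple_cycle_def is_cycle_iff_closed_list[OF assms])
qed

lemma simple_cycles_at_iff:
  "p \<in> simple_cycles_at E U v \<longleftrightarrow> closed_list E p \<and> distinct p \<and> hd p = v \<and> set p \<subseteq> U"
proof (cases p)
  case (Cons x q)
  then show ?thesis
    using set_zip_Cons_snoc[of x q x E] successively_append_iff[of "\<lambda>a b. (a, b) \<in> E" p "[x]"]
    by (auto simp: simple_cycles_at_def closed_list_def)
qed (simp add: simple_cycles_at_def closed_list_def)

abbreviation cycle_class :: "'a list \<Rightarrow> ('a \<times> 'a) list set" where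
  "cycle_class p \<equiv> rotation_rel `` {cyclic_pairs p}"

lemma cycle_class_rotate: "cycle_class (rotate k p) = cycle_class p"
  by (rule equiv_class_eq[OF equiv_rotation_rel, symmetric])
    (auto simp: rotation_rel_def simp flip: rotate_cyclic_pairs)

lemma class_verts_cycle_class: "class_verts (cycle_class p) = set p"
proof -
  have "fst ` set (rotate k (cyclic_pairs p)) = set p" for k
    by (metis map_fst_cyclic_pairs set_map set_rotate)
  then show ?thesis unfolding class_verts_def rotation_rel_Image by simp
qed

lemma class_length_cycle_class: "class_length (cycle_class p) = length p"
  by (simp add: class_length_Image)

lemma simple_classes_eq:
  assumes "pair_wf_digraph H"
  shows "simple_classes H = cycle_class ` {p. closed_list (parcs H) p \<and> distinct p}"
  unfolding simple_classes_def simple_cycles_eq[OF assms] quotient_def by auto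

lemma finite_simple_classes:
  assumes "pair_fin_digraph H"
  shows "finite (simple_classes H)"
proof -
  interpret pair_fin_digraph H by fact
  have "{p. closed_list (parcs H) p \<and> distinct p} \<subseteq> {p. set p \<subseteq> pverts H \<and> distinct p}"
    using closed_list_subset[OF pair_wf_digraph_axioms] by auto
  then have "finite {p. closed_list (parcs H) p \<and> distinct p}"
    using finite_subset_distinct[OF pair_finite_verts] by (rule finite_subset)
  then show ?thesis unfolding simple_classes_eq[OF pair_wf_digraph_axioms] by (rule finite_imageI)
qed

lemma simple_classes_facts:
  assumes "pair_wf_digraph H" "c \<in> simple_classes H"
  shows "class_length c = card (class_verts c)" "class_length c > 0" "class_verts c \<subseteq> pverts H"
proof -
  obtain p where p: "closed_list (parcs H) p" "distinct p" and c: "c = cycle_class p"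
    using assms by (auto simp: simple_classes_eq)
  show "class_length c = card (class_verts c)"
    using p by (simp add: c class_length_cycle_class class_verts_cycle_class distinct_card)
  show "class_length c > 0" using p by (simp add: c class_length_cycle_class closed_list_def)
  show "class_verts c \<subseteq> pverts H"
    using closed_list_subset[OF assms(1) p(1)] by (simp add: c class_verts_cycle_class)
qed

lemma bij_betw_cycle_class:
  assumes "pair_wf_digraph H"
  shows "bij_betw cycle_class (simple_cycles_at (parcs H) U v)
    {c \<in> simple_classes H. class_verts c \<subseteq> U \<and> v \<in> class_verts c}"
  unfolding bij_betw_def
proof
  show "inj_on cycle_class (simple_cycles_at (parcs H) U v)"
  proof (rule inj_onI)
    fix p q assume p: "p \<in> simple_cycles_at (parcs H) U v" and q: "q \<in> simple_cycles_at (parcs H) U v"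
      and "cycle_class p = cycle_class q"
    then have "cyclic_pairs q \<in> cycle_class p"
      using equiv_class_self[OF equiv_rotation_rel, of "cyclic_pairs q"] by simp
    then obtain k where "cyclic_pairs q = cyclic_pairs (rotate k p)"
      by (auto simp: rotation_rel_Image rotate_cyclic_pairs)
    then have qk: "q = rotate k p" by (metis map_fst_cyclic_pairs)
    have pne: "p \<noteq> []" "distinct p" "hd p = hd q"
      using p q by (simp_all add: simple_cycles_at_iff closed_list_def)
    then have "p ! 0 = p ! (k mod length p)"
      by (simp add: qk hd_conv_nth nth_rotate)
    then have "k mod length p = 0"
      using pne by (subst (asm) nth_eq_iff_index_eq) auto
    then show "p = q" unfolding qk by (metis id_apply rotate0 rotate_conv_mod)
  qed
  show "cycle_class ` simple_cycles_at (parcs H) U v =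
    {c \<in> simple_classes H. class_verts c \<subseteq> U \<and> v \<in> class_verts c}"
  proof (intro equalityI subsetI)
    fix c assume "c \<in> cycle_class ` simple_cycles_at (parcs H) U v"
    then obtain p where p: "p \<in> simple_cycles_at (parcs H) U v" and c: "c = cycle_class p" by blast
    then have "v \<in> set p" by (auto simp: simple_cycles_at_iff closed_list_def)
    then show "c \<in> {c \<in> simple_classes H. class_verts c \<subseteq> U \<and> v \<in> class_verts c}"
      using p by (auto simp: c simple_cycles_at_iff simple_classes_eq[OF assms] class_verts_cycle_class)
  next
    fix c assume "c \<in> {c \<in> simple_classes H. class_verts c \<subseteq> U \<and> v \<in> class_verts c}"
    then obtain p where p: "closed_list (parcs H) p" "distinct p" "set p \<subseteq> U" "v \<in> set p"
      and c: "c = cycle_class p"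
      by (auto simp: simple_classes_eq[OF assms] class_verts_cycle_class)
    obtain a b where "p = a @ v # b" using p(4) by (auto simp: in_set_conv_decomp)
    then have "hd (rotate (length a) p) = v" by (simp add: rotate_append)
    then have "rotate (length a) p \<in> simple_cycles_at (parcs H) U v"
      using p by (simp add: simple_cycles_at_iff closed_list_rotate)
    moreover have "c = cycle_class (rotate (length a) p)" by (simp add: c cycle_class_rotate)
    ultimately show "c \<in> cycle_class ` simple_cycles_at (parcs H) U v" by blast
  qed
qed

definition cycle_poly :: "'v pair_pre_digraph \<Rightarrow> 'v set \<Rightarrow> rat fps" where
  "cycle_poly H U = indep_poly (\<lambda>c d. class_verts c \<inter> class_verts d = {})
     (\<lambda>c. fps_X ^ card (class_verts c)) {c \<in> simple_classes H. class_verts c \<subseteq> U}"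

lemma cycle_poly_remove:
  assumes "pair_fin_digraph H"
  shows "cycle_poly H U = cycle_poly H (U - {v}) -
    (\<Sum>p\<in>simple_cycles_at (parcs H) U v. fps_X ^ length p * cycle_poly H (U - set p))"
proof -
  interpret pair_fin_digraph H by fact
  let ?I = "\<lambda>c d :: ('a \<times> 'a) list set. class_verts c \<inter> class_verts d = {}"
  let ?w = "\<lambda>c. fps_X ^ card (class_verts c) :: rat fps"
  let ?U = "{c \<in> simple_classes H. class_verts c \<subseteq> U}"
  let ?K = "{c \<in> simple_classes H. class_verts c \<subseteq> U \<and> v \<in> class_verts c}"
  have "indep_poly ?I ?w ?U =
    indep_poly ?I ?w (?U - ?K) - (\<Sum>c\<in>?K. ?w c * indep_poly ?I ?w {d \<in> ?U - ?K. ?I c d})"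
    using finite_simple_classes[OF assms]
    by (intro indep_poly_remove_clique) (auto intro: sympI)
  also have "?U - ?K = {c \<in> simple_classes H. class_verts c \<subseteq> U - {v}}" by auto
  also have "(\<Sum>c\<in>?K. ?w c * indep_poly ?I ?w {d \<in> {c \<in> simple_classes H. class_verts c \<subseteq> U - {v}}. ?I c d}) =
    (\<Sum>c\<in>?K. ?w c * cycle_poly H (U - class_verts c))"
  proof (rule sum.cong[OF refl])
    fix c assume "c \<in> ?K"
    then have "{d \<in> {c \<in> simple_classes H. class_verts c \<subseteq> U - {v}}. ?I c d} =
      {d \<in> simple_classes H. class_verts d \<subseteq> U - class_verts c}" by auto
    then show "?w c * indep_poly ?I ?w {d \<in> {c \<in> simple_classes H. class_verts c \<subseteq> U - {v}}. ?I c d} =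
      ?w c * cycle_poly H (U - class_verts c)" by (simp only: cycle_poly_def)
  qed
  also have "\<dots> = (\<Sum>p\<in>simple_cycles_at (parcs H) U v.
      fps_X ^ card (class_verts (cycle_class p)) * cycle_poly H (U - class_verts (cycle_class p)))"
    by (rule sum.reindex_bij_betw[OF bij_betw_cycle_class, symmetric]) unfold_locales
  also have "\<dots> = (\<Sum>p\<in>simple_cycles_at (parcs H) U v. fps_X ^ length p * cycle_poly H (U - set p))"
    by (intro sum.cong refl)
      (simp add: class_verts_cycle_class simple_cycles_at_iff distinct_card)
  finally show ?thesis by (simp add: cycle_poly_def)
qed

lemma fps_X_mult_deriv_cycle_poly:
  assumes "pair_fin_digraph H"
  shows "fps_X * fps_deriv (cycle_poly H (pverts H)) =
    - (cycle_poly H (pverts H) * closed_series (parcs H))"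
proof -
  interpret pair_fin_digraph H by fact
  let ?V = "pverts H"
  let ?U = "{c \<in> simple_classes H. class_verts c \<subseteq> ?V}"
  have "fps_X * fps_deriv (cycle_poly H ?V) = (\<Sum>v\<in>?V. cycle_poly H ?V -
      indep_poly (\<lambda>c d. class_verts c \<inter> class_verts d = {}) (\<lambda>c. fps_X ^ card (class_verts c))
        {c \<in> ?U. v \<notin> class_verts c})"
    unfolding cycle_poly_def
    using finite_simple_classes[OF assms] pair_finite_verts
    by (intro fps_X_mult_deriv_indep_poly) auto
  also have "\<dots> = (\<Sum>v\<in>?V. cycle_poly H ?V - cycle_poly H (?V - {v}))"
  proof (rule sum.cong[OF refl])
    fix v
    have "{c \<in> ?U. v \<notin> class_verts c} = {c \<in> simple_classes H. class_verts c \<subseteq> ?V - {v}}" by auto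
    then show "cycle_poly H ?V - indep_poly (\<lambda>c d. class_verts c \<inter> class_verts d = {})
        (\<lambda>c. fps_X ^ card (class_verts c)) {c \<in> ?U. v \<notin> class_verts c} =
      cycle_poly H ?V - cycle_poly H (?V - {v})" by (simp only: cycle_poly_def)
  qed
  also have "\<dots> = - (\<Sum>v\<in>?V. cycle_poly H (?V - {v}) - cycle_poly H ?V)"
    by (simp flip: sum_negf)
  also have "(\<Sum>v\<in>?V. cycle_poly H (?V - {v}) - cycle_poly H ?V) =
      cycle_poly H ?V * closed_series (parcs H)"
    using pair_finite_verts in_arcsD1 in_arcsD2 cycle_poly_remove[OF assms]
    by (intro mult_closed_series[symmetric]) auto
  finally show ?thesis .
qed

lemma cycle_poly_nth_0:
  assumes "pair_fin_digraph H"
  shows "fps_nth (cycle_poly H U) 0 = 1"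
proof -
  interpret pair_fin_digraph H by fact
  let ?T = "{S. S \<subseteq> {c \<in> simple_classes H. class_verts c \<subseteq> U} \<and>
    pairwise (\<lambda>c d. class_verts c \<inter> class_verts d = {}) S}"
  let ?t = "\<lambda>S :: ('a \<times> 'a) list set set. fps_nth (\<Prod>c\<in>S. - (fps_X ^ card (class_verts c)) :: rat fps) 0"
  have fin: "finite ?T"
    using finite_simple_classes[OF assms]
    by (auto intro: finite_subset[of _ "Pow (simple_classes H)"])
  have "?t S = 0" if S: "S \<in> ?T - {{}}" for S
  proof -
    obtain c where c: "c \<in> S" using S by auto
    then have "c \<in> simple_classes H" using S by auto
    then have "card (class_verts c) > 0"
      using simple_classes_facts[OF pair_wf_digraph_axioms] by metis
    moreover have "finite S" using S finite_simple_classes[OF assms] by (auto intro: finite_subset)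
    ultimately show ?thesis using c by (simp add: prod.remove)
  qed
  then have "sum ?t ?T = sum ?t {{}}" using fin by (intro sum.mono_neutral_right) auto
  then show ?thesis by (simp add: cycle_poly_def indep_poly_def fps_sum_nth)
qed


section \<open>The Ihara zeta function\<close>

lemma reduced_cycle_iff:
  assumes "is_cycle G C"
  shows "reduced_cycle G C \<longleftrightarrow> (\<forall>(e, f) \<in> set (cyclic_pairs C). prod.swap e \<noteq> f)"
proof -
  have "(\<forall>(e, f) \<in> set (cyclic_pairs C). prod.swap e \<noteq> f) \<longleftrightarrow>
    list_all2 (\<lambda>e f. prod.swap e \<noteq> f) C (rotate1 C)"
    by (auto simp: list_all2_iff)
  also have "\<dots> \<longleftrightarrow> (\<forall>k<length C. prod.swap (C ! k) \<noteq> C ! (Suc k mod length C))"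
    by (simp add: list_all2_conv_all_nth nth_rotate1)
  also have "\<dots> \<longleftrightarrow> (\<forall>k<length C. prod.swap (C ! (Suc k mod length C)) \<noteq> C ! k)"
    by (metis swap_swap)
  finally show ?thesis using assms by (simp add: reduced_cycle_def)
qed

lemma map_eq_rotate1_iff:
  "map snd C = rotate1 (map fst C) \<longleftrightarrow> (\<forall>(e, f) \<in> set (cyclic_pairs C). snd e = fst f)"
proof -
  have "map snd C = rotate1 (map fst C) \<longleftrightarrow> list_all2 (\<lambda>e f. snd e = fst f) C (rotate1 C)"
    by (simp add: rotate1_map list_all2_conv_all_nth list_eq_iff_nth_eq)
  then show ?thesis by (auto simp: list_all2_iff)
qed

lemma reduced_cycle_iff_closed_list:
  assumes "pair_wf_digraph G"
  shows "reduced_cycle G C \<longleftrightarrow> closed_list (parcs (line_digraph_wb G)) C"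
proof -
  have "set C \<subseteq> parcs G \<longleftrightarrow> (\<forall>(e, f) \<in> set (cyclic_pairs C). e \<in> parcs G \<and> f \<in> parcs G)"
  proof
    assume "\<forall>(e, f) \<in> set (cyclic_pairs C). e \<in> parcs G \<and> f \<in> parcs G"
    then have "fst ` set (cyclic_pairs C) \<subseteq> parcs G" by auto
    then show "set C \<subseteq> parcs G" by (metis map_fst_cyclic_pairs set_map)
  next
    assume "set C \<subseteq> parcs G"
    moreover have "e \<in> set C" "f \<in> set C" if "(e, f) \<in> set (cyclic_pairs C)" for e f
      using set_zip_leftD[OF that] set_zip_rightD[OF that] by simp_all
    ultimately show "\<forall>(e, f) \<in> set (cyclic_pairs C). e \<in> parcs G \<and> f \<in> parcs G" by blast
  qed
  then have "closed_list (parcs (line_digraph_wb G)) C \<longleftrightarrow>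
    is_cycle G C \<and> (\<forall>(e, f) \<in> set (cyclic_pairs C). prod.swap e \<noteq> f)"
    unfolding is_cycle_iff[OF assms] map_eq_rotate1_iff closed_list_def line_digraph_wb_def by auto
  moreover have "reduced_cycle G C \<Longrightarrow> is_cycle G C" by (simp add: reduced_cycle_def)
  ultimately show ?thesis using reduced_cycle_iff by blast
qed

lemma is_cycle_list_power:
  assumes "pair_wf_digraph G" "r > 0"
  shows "is_cycle G (list_power C r) \<longleftrightarrow> is_cycle G C"
proof -
  have "map f (list_power C r) = list_power (map f C) r" for f :: "'a \<times> 'a \<Rightarrow> 'a"
    by (simp add: map_concat)
  moreover have "list_power p r = list_power q r \<longleftrightarrow> p = q" if "length p = length q" for p q :: "'a list"
    using assms(2) that by (cases r) auto
  ultimately show ?thesis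
    using assms(2) unfolding is_cycle_iff[OF assms(1)] by (auto simp: rotate1_list_power)
qed

lemma prime_reduced_cycles_eq:
  assumes "pair_wf_digraph G"
  shows "{C. prime_cycle G C \<and> reduced_cycle G C} =
    {C. closed_list (parcs (line_digraph_wb G)) C \<and> primitive C}"
proof -
  have "prime_cycle G C \<longleftrightarrow> primitive C" if "is_cycle G C" for C
  proof -
    have "C \<noteq> []" using that by (simp add: is_cycle_def)
    moreover have "is_cycle G B" if "r \<ge> 2" "C = list_power B r" for B r
      using that \<open>is_cycle G C\<close> is_cycle_list_power[OF assms, of r B] by simp
    ultimately show ?thesis using that unfolding prime_cycle_def primitive_def by blast
  qed
  moreover have "reduced_cycle G C \<Longrightarrow> is_cycle G C" for C by (simp add: reduced_cycle_def)
  ultimately show ?thesis using reduced_cycle_iff_closed_list[OF assms] by blast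
qed

lemma pair_fin_digraph_line_digraph_wb:
  assumes "pair_fin_digraph G"
  shows "pair_fin_digraph (line_digraph_wb G)"
proof -
  interpret pair_fin_digraph G by fact
  have "parcs (line_digraph_wb G) \<subseteq> parcs G \<times> parcs G" by (auto simp: line_digraph_wb_def)
  then have "finite (parcs (line_digraph_wb G))"
    using pair_finite_arcs by (auto intro: finite_subset)
  then show ?thesis
    by unfold_locales (auto simp: line_digraph_wb_def pair_finite_arcs)
qed

lemma inverse_ihara_zeta:
  assumes "pair_fin_digraph G"
  shows "inverse (ihara_zeta G) = cycle_poly (line_digraph_wb G) (parcs G)"
proof -
  let ?H = "line_digraph_wb G" and ?P = "cycle_poly (line_digraph_wb G) (parcs G)"
  interpret G: pair_fin_digraph G by fact
  interpret H: pair_fin_digraph ?H by (rule pair_fin_digraph_line_digraph_wb[OF assms])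
  have V: "pverts ?H = parcs G" by (simp add: line_digraph_wb_def)
  have P0: "fps_nth ?P 0 = 1" by (rule cycle_poly_nth_0[OF H.pair_fin_digraph_axioms])
  have "((\<lambda>F. \<Prod>c\<in>F. inverse (1 - fps_X ^ class_length c)) \<longlongrightarrow> inverse ?P)
    (finite_subsets_at_top (prime_reduced_classes G))"
    unfolding prime_reduced_classes_def prime_reduced_cycles_eq[OF G.pair_wf_digraph_axioms]
    using fps_X_mult_deriv_cycle_poly[OF H.pair_fin_digraph_axioms] P0 H.pair_finite_arcs
    by (intro prod_inverse_tendsto) (simp_all add: V)
  then have "ihara_zeta G = inverse ?P"
    unfolding ihara_zeta_def by (rule tendsto_Lim[OF finite_subsets_at_top_neq_bot])
  then show ?thesis using P0 by simp
qed


section \<open>Closures\<close>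

lemma det_closure:
  fixes w :: "'h \<Rightarrow> 'r::idom"
  assumes h: "bij_betw h {..<n} V" and K: "is_closure V N K"
    and N: "\<And>c d. c \<in> V \<Longrightarrow> d \<in> V \<Longrightarrow> c \<noteq> d \<Longrightarrow> {c, d} \<in> N \<longleftrightarrow> \<not> I c d"
  shows "det (1\<^sub>m n - mat_diag n (\<lambda>i. w (h i)) * adjacency_matrix n h K) = indep_poly I w V"
proof -
  define L where "L i j \<longleftrightarrow> (h i, h j) \<in> parcs K \<and> (h j, h i) \<notin> parcs K" for i j
  have hV: "h i \<in> V" if "i < n" for i using h that by (auto simp: bij_betw_def)
  have hinj: "h i = h j \<longleftrightarrow> i = j" if "i < n" "j < n" for i j
    using h that by (auto simp: bij_betw_def inj_on_def)
  have refl: "(c, c) \<in> parcs K" if "c \<in> V" for c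
    using K that unfolding is_closure_def by blast
  have edges: "(c, d) \<in> parcs K" if "c \<in> V" "d \<in> V" "c \<noteq> d" "{c, d} \<in> N" for c d
    using K that unfolding is_closure_def by blast
  have nonedges: "(c, d) \<in> parcs K \<longleftrightarrow> (d, c) \<notin> parcs K" if "c \<in> V" "d \<in> V" "c \<noteq> d" "{c, d} \<notin> N" for c d
    using K that unfolding is_closure_def by blast
  have fork: "(s, u) \<in> parcs K \<longleftrightarrow> (t, u) \<in> parcs K"
    if "s \<in> V" "t \<in> V" "u \<in> V" "s \<noteq> t" "t \<noteq> u" "s \<noteq> u" "{s, t} \<in> N" "{s, u} \<notin> N" "{t, u} \<notin> N" for s t u
  proof -
    have "((s, u) \<in> parcs K \<and> (t, u) \<in> parcs K) \<or> ((u, s) \<in> parcs K \<and> (u, t) \<in> parcs K)"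
      using K that unfolding is_closure_def by blast
    then show ?thesis using nonedges[of s u] nonedges[of t u] that by blast
  qed
  have triangle: "\<not> ((s, t) \<in> parcs K \<and> (t, u) \<in> parcs K \<and> (u, s) \<in> parcs K)"
    if "s \<in> V" "t \<in> V" "u \<in> V" "s \<noteq> t" "t \<noteq> u" "s \<noteq> u" "{s, t} \<notin> N" "{s, u} \<notin> N" "{t, u} \<notin> N" for s t u
    using K that unfolding is_closure_def by blast
  have arc: "(h i, h j) \<in> parcs K \<longleftrightarrow> \<not> L j i"
    and L_iff: "i \<noteq> j \<Longrightarrow> L i j \<or> L j i \<longleftrightarrow> I (h i) (h j)" if "i < n" "j < n" for i j
  proof -
    note V = hV[OF that(1)] hV[OF that(2)]
    have ne: "h i \<noteq> h j" if "i \<noteq> j" using hinj[OF \<open>i < n\<close> \<open>j < n\<close>] that by simp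
    consider (eq) "i = j" | (edge) "i \<noteq> j" "{h i, h j} \<in> N" | (nonedge) "i \<noteq> j" "{h i, h j} \<notin> N"
      by blast
    then have "((h i, h j) \<in> parcs K \<longleftrightarrow> \<not> L j i) \<and> (i \<noteq> j \<longrightarrow> (L i j \<or> L j i \<longleftrightarrow> I (h i) (h j)))"
    proof cases
      case eq
      then show ?thesis using refl[OF V(1)] by (simp add: L_def)
    next
      case edge
      then have "(h i, h j) \<in> parcs K" "(h j, h i) \<in> parcs K"
        using edges[of "h i" "h j"] edges[of "h j" "h i"] V ne by (simp_all add: insert_commute)
      then show ?thesis using edge ne N[OF V] by (simp add: L_def)
    next
      case nonedge
      then have "(h i, h j) \<in> parcs K \<longleftrightarrow> (h j, h i) \<notin> parcs K"
        using nonedges[of "h i" "h j"] V ne by blast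
      then show ?thesis using nonedge ne N[OF V] unfolding L_def by blast
    qed
    then show "(h i, h j) \<in> parcs K \<longleftrightarrow> \<not> L j i"
      and "i \<noteq> j \<Longrightarrow> L i j \<or> L j i \<longleftrightarrow> I (h i) (h j)" by blast+
  qed
  \<comment> \<open>The two closure conditions on triples say exactly that the orientation of the commutation
    graph is transitive.\<close>
  have irrefl: "irreflp_on {..<n} L" by (auto simp: L_def intro: irreflp_onI)
  have trans: "transp_on {..<n} L"
  proof (rule transp_onI)
    fix i j k assume "i \<in> {..<n}" "j \<in> {..<n}" "k \<in> {..<n}" and L: "L i j" "L j k"
    then have V: "h i \<in> V" "h j \<in> V" "h k \<in> V" using hV by auto
    have ne: "h i \<noteq> h j" "h j \<noteq> h k" "h i \<noteq> h k" using L by (auto simp: L_def)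
    have ij: "{h i, h j} \<notin> N" and jk: "{h j, h k} \<notin> N"
      using L edges[of "h j" "h i"] edges[of "h k" "h j"] V ne
      by (auto simp: L_def insert_commute)
    show "L i k"
    proof (cases "{h i, h k} \<in> N")
      case True
      have "{h k, h j} \<notin> N" using jk by (simp add: insert_commute)
      then have "(h i, h j) \<in> parcs K \<longleftrightarrow> (h k, h j) \<in> parcs K"
        using True fork[of "h i" "h k" "h j"] V ne ij by metis
      then show ?thesis using L by (simp add: L_def)
    next
      case False
      then have "(h k, h i) \<notin> parcs K"
        using triangle[of "h i" "h j" "h k"] V ne ij jk L by (metis L_def)
      then show ?thesis using nonedges[of "h i" "h k"] V ne False by (simp add: L_def)
    qed
  qed
  have "mat_diag n (\<lambda>i. w (h i)) * adjacency_matrix n h K =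
    mat n n (\<lambda>(i, j). w (h i) * (if L j i then 0 else 1))"
    unfolding adjacency_matrix_def
    by (subst mat_diag_mult_left[of _ n n]) (auto simp: arc intro!: cong_mat)
  then have "1\<^sub>m n - mat_diag n (\<lambda>i. w (h i)) * adjacency_matrix n h K =
    mat n n (\<lambda>(i, j). (if i = j then 1 else 0) - w (h i) * (if L j i then 0 else 1))"
    by (intro eq_matI) auto
  also have "det \<dots> = indep_poly (\<lambda>i j. L i j \<or> L j i) (\<lambda>i. w (h i)) {..<n}"
    by (rule det_poset_eq_indep_poly[OF irrefl trans])
  also have "\<dots> = indep_poly I w V"
    by (rule indep_poly_reindex[OF h, symmetric]) (simp add: L_iff)
  finally show ?thesis .
qed

theorem theorem1p1:
  fixes G :: "'v pair_pre_digraph"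
    and n :: nat
    and h :: "nat \<Rightarrow> (('v \<times> 'v) \<times> ('v \<times> 'v)) list set"
    and K :: "(('v \<times> 'v) \<times> ('v \<times> 'v)) list set pair_pre_digraph"
  assumes "pair_digraph G"
    and "Digraph_Component.connected (with_proj G)"
    and "bij_betw h {..<n} (hike_generators G)"
    and "is_closure (hike_generators G) (noncommutation_edges G) K"
  shows "inverse (ihara_zeta G) =
    det (1\<^sub>m n - weight_matrix n h * adjacency_matrix n h K)"
proof -
  let ?H = "line_digraph_wb G"
  let ?I = "\<lambda>c d :: (('v \<times> 'v) \<times> ('v \<times> 'v)) list set. class_verts c \<inter> class_verts d = {}"
  interpret G: pair_digraph G by fact
  interpret H: pair_fin_digraph ?H
    by (rule pair_fin_digraph_line_digraph_wb[OF G.pair_fin_digraph_axioms])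
  note facts = simple_classes_facts[OF H.pair_wf_digraph_axioms]
  have N: "{c, d} \<in> noncommutation_edges G \<longleftrightarrow> \<not> ?I c d"
    if "c \<in> hike_generators G" "d \<in> hike_generators G" "c \<noteq> d" for c d
    using that by (auto simp: noncommutation_edges_def hike_independence_def doubleton_eq_iff)
  have "det (1\<^sub>m n - weight_matrix n h * adjacency_matrix n h K) =
    indep_poly ?I (\<lambda>c. fps_X ^ class_length c) (hike_generators G)"
    unfolding weight_matrix_def using assms(3,4) N by (rule det_closure)
  also have "\<dots> = indep_poly ?I (\<lambda>c. fps_X ^ card (class_verts c)) (hike_generators G)"
    unfolding indep_poly_def by (intro sum.cong prod.cong) (auto simp: facts(1))
  also have "\<dots> = cycle_poly ?H (parcs G)"
  proof -
    have "{c \<in> hike_generators G. class_verts c \<subseteq> parcs G} = hike_generators G"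
      using facts(3) by (auto simp: line_digraph_wb_def)
    then show ?thesis by (simp add: cycle_poly_def)
  qed
  also have "\<dots> = inverse (ihara_zeta G)"
    by (rule inverse_ihara_zeta[OF G.pair_fin_digraph_axioms, symmetric])
  finally show ?thesis ..
qed

end
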